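(* For every positive integer $n$, the number of vertex orbits of the Lucas cube is \[ o_V(\Lambda_n) = \frac{1}{2}\left(\frac{1}{n}\sum_{d\mid n}\varphi\!\left(\frac{n}{d}\right) L_d + \sum_{0\le a\le \lfloor n/2\rfloor}\binom{\lfloor n/2\rfloor - \lfloor (a+1)/2\rfloor}{\lfloor a/2\rfloor}\right). \]
   Context: A Lucas string of length $n$ is a binary string $u_1\cdots u_n$ with no two consecutive 1s and not both $u_1=1$ and $u_n=1$. The Lucas cube $\Lambda_n$ is the subgraph of the $n$-cube $Q_n$ (binary strings of length $n$, adjacent iff they differ in exactly one position) induced by the Lucas strings of length $n$. $o_V(\Lambda_n)$ is the number of orbits of ${\rm Aut}(\Lambda_n)$ acting on $V(\Lambda_n)$. $\varphi$ is Euler's totient function, $L_d$ are the Lucas numbers ($L_0=2$, $L_1=1$, $L_d=L_{d-1}+L_{d-2}$), and the first sum runs over positive divisors $d$ of $n$. *)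

theory Defs
  imports "HOL-Algebra.Group_Action" "HOL-Number_Theory.Totient"
begin

section \<open>Finite simple graphs\<close>

text \<open>An edge is the two-element set of its end points.\<close>

record 'a sgraph =
  verts :: "'a set"
  edges :: "'a set set"

definition finite_simple_graph :: "'a sgraph \<Rightarrow> bool" where
  "finite_simple_graph G \<longleftrightarrow> finite (verts G) \<and>
     (\<forall>e \<in> edges G. e \<subseteq> verts G \<and> card e = 2)"

definition induced_subgraph :: "'a sgraph \<Rightarrow> 'a set \<Rightarrow> 'a sgraph" where
  "induced_subgraph G W =
     \<lparr>verts = verts G \<inter> W, edges = {e \<in> edges G. e \<subseteq> W}\<rparr>"

definition automorphisms :: "'a sgraph \<Rightarrow> ('a \<Rightarrow> 'a) set" where
  "automorphisms G = {f \<in> Bij (verts G).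
     \<forall>u \<in> verts G. \<forall>v \<in> verts G. {f u, f v} \<in> edges G \<longleftrightarrow> {u, v} \<in> edges G}"

definition Aut :: "'a sgraph \<Rightarrow> ('a \<Rightarrow> 'a) monoid" where
  "Aut G = (BijGroup (verts G))\<lparr>carrier := automorphisms G\<rparr>"

definition num_vertex_orbits :: "'a sgraph \<Rightarrow> nat" where
  "num_vertex_orbits G = card (orbits (Aut G) (verts G) (\<lambda>f. f))"

lemma subgroup_automorphisms: "subgroup (automorphisms G) (BijGroup (verts G))"
proof -
  interpret B: group "BijGroup (verts G)" by (rule group_BijGroup)
  have mem: "f x \<in> verts G" if "f \<in> Bij (verts G)" "x \<in> verts G" for f x
    using that Bij_imp_funcset by blast
  show ?thesis
  proof (rule B.subgroupI)
    show "automorphisms G \<subseteq> carrier (BijGroup (verts G))"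
      by (auto simp: automorphisms_def BijGroup_def)
    have "(\<lambda>x \<in> verts G. x) \<in> automorphisms G"
      by (simp add: automorphisms_def id_Bij)
    then show "automorphisms G \<noteq> {}" by blast
  next
    fix f assume f: "f \<in> automorphisms G"
    then have fB: "f \<in> Bij (verts G)" by (simp add: automorphisms_def)
    let ?g = "\<lambda>x \<in> verts G. inv_into (verts G) f x"
    have gB: "?g \<in> Bij (verts G)" by (rule restrict_inv_into_Bij[OF fB])
    have fg: "f (?g x) = x" if "x \<in> verts G" for x
      using that fB by (auto simp: Bij_def bij_betw_def f_inv_into_f)
    have "{?g u, ?g v} \<in> edges G \<longleftrightarrow> {u, v} \<in> edges G"
      if "u \<in> verts G" "v \<in> verts G" for u v
    proof -
      have "{f (?g u), f (?g v)} \<in> edges G \<longleftrightarrow> {?g u, ?g v} \<in> edges G"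
        using f mem[OF gB that(1)] mem[OF gB that(2)]
        unfolding automorphisms_def by blast
      then show ?thesis unfolding fg[OF that(1)] fg[OF that(2)] by blast
    qed
    then show "inv\<^bsub>BijGroup (verts G)\<^esub> f \<in> automorphisms G"
      unfolding inv_BijGroup[OF fB] using gB by (simp add: automorphisms_def)
  next
    fix f g assume f: "f \<in> automorphisms G" and g: "g \<in> automorphisms G"
    then have B: "f \<in> Bij (verts G)" "g \<in> Bij (verts G)" by (auto simp: automorphisms_def)
    have "compose (verts G) f g \<in> automorphisms G"
      using f g mem[OF B(2)] by (simp add: automorphisms_def compose_Bij compose_eq)
    then show "f \<otimes>\<^bsub>BijGroup (verts G)\<^esub> g \<in> automorphisms G"
      using B by (simp add: BijGroup_def)
  qed
qed

lemma Aut_acts_on_verts: "group_action (Aut G) (verts G) (\<lambda>f. f)"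
  using subgroup.subgroup_is_group[OF subgroup_automorphisms group_BijGroup, of G]
    group_BijGroup[of "verts G"] subgroup.subset[OF subgroup_automorphisms, of G]
  by (auto simp: group_action_def group_hom_def group_hom_axioms_def hom_def Aut_def)


section \<open>Lucas cubes\<close>

text \<open>A binary string \<open>u\<^sub>1 \<dots> u\<^sub>n\<close> is a Boolean list, with \<^term>\<open>True\<close> for the digit \<open>1\<close>
  and the letter \<open>u\<^sub>i\<close> at list position \<open>i - 1\<close>.\<close>

definition binary_strings :: "nat \<Rightarrow> bool list set" where
  "binary_strings n = {u. length u = n}"

definition hypercube :: "nat \<Rightarrow> bool list sgraph" where
  "hypercube n = \<lparr>verts = binary_strings n,
     edges = {{u, v} | u v. u \<in> binary_strings n \<and> v \<in> binary_strings n \<and>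
                            card {i. i < n \<and> u ! i \<noteq> v ! i} = 1}\<rparr>"

text \<open>For \<open>n = 1\<close> the first and the last letter coincide, so that the string \<open>1\<close> is not a Lucas
  string. The guard \<open>0 < n\<close> keeps the empty string, which has no first or last letter.\<close>

definition lucas_strings :: "nat \<Rightarrow> bool list set" where
  "lucas_strings n = {u \<in> binary_strings n.
     (\<forall>i. Suc i < n \<longrightarrow> \<not> (u ! i \<and> u ! Suc i)) \<and>
     (0 < n \<longrightarrow> \<not> (u ! 0 \<and> u ! (n - 1)))}"

definition lucas_cube :: "nat \<Rightarrow> bool list sgraph" where
  "lucas_cube n = induced_subgraph (hypercube n) (lucas_strings n)"

fun lucas :: "nat \<Rightarrow> nat" where
  "lucas 0 = 2"
| "lucas (Suc 0) = 1"
| "lucas (Suc (Suc n)) = lucas (Suc n) + lucas n"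

lemma finite_simple_graph_induced:
  "finite_simple_graph G \<Longrightarrow> finite_simple_graph (induced_subgraph G W)"
  by (auto simp: finite_simple_graph_def induced_subgraph_def)

lemma finite_simple_graph_hypercube: "finite_simple_graph (hypercube n)"
proof -
  have "finite (binary_strings n)"
    using finite_lists_length_eq[of "UNIV :: bool set" n] by (simp add: binary_strings_def)
  moreover have "card {u, v} = 2"
    if "card {i. i < n \<and> u ! i \<noteq> v ! i} = 1" for u v :: "bool list"
    using that by (cases "u = v") auto
  ultimately show ?thesis
    by (auto simp: finite_simple_graph_def hypercube_def)
qed

lemma finite_simple_graph_lucas_cube: "finite_simple_graph (lucas_cube n)"
  unfolding lucas_cube_def
  by (intro finite_simple_graph_induced finite_simple_graph_hypercube)

end

theory Submission
  imports Defs "HOL-Number_Theory.Fib" "HOL-Number_Theory.Cong"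
begin

text \<open>The Lucas strings are the independent sets of the cycle on \<open>\<int>/n\<close>. An automorphism of the Lucas
  cube fixes the zero string, the only vertex of degree \<open>n\<close>, and hence permutes its neighbours, the
  unit strings. Two unit strings have a second common neighbour iff their positions are not adjacent
  on the cycle, so this permutation is a rotation or a reflection. After composing with its inverse
  all unit strings are fixed, and then every vertex \<open>u\<close> is: by induction on its weight, it is a
  common neighbour of two fixed vertices \<open>u - a\<close> and \<open>u - b\<close>, and the only other common neighbour
  \<open>u - a - b\<close> is fixed as well. Hence the orbits are those of the dihedral group. In Burnside's
  count, rotation by \<open>c\<close> fixes \<open>L\<^bsub>gcd(c,n)\<^esub>\<close> strings, and the reflections fix palindromes, which number
  \<open>F\<^bsub>\<lfloor>n/2\<rfloor>+2\<^esub>\<close> on average; the sum of binomial coefficients is that Fibonacci number.\<close>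

section \<open>Burnside's lemma\<close>

text \<open>Pairs \<open>(g, x)\<close> with \<open>act g x = x\<close> are counted twice, and each
  orbit contributes \<open>card G\<close> of them. The set \<open>G\<close> carries only a
  multiplication with bijective right translations, so that it can be a set of parameters whose
  action is not faithful.\<close>

lemma sum_card_fixed_points:
  fixes act :: "'g \<Rightarrow> 'x \<Rightarrow> 'x"
  assumes "finite G" "finite X"
    and closed: "\<And>g x. g \<in> G \<Longrightarrow> x \<in> X \<Longrightarrow> act g x \<in> X"
    and one: "e \<in> G" "\<And>x. x \<in> X \<Longrightarrow> act e x = x"
    and mult: "\<And>g h x. g \<in> G \<Longrightarrow> h \<in> G \<Longrightarrow> x \<in> X \<Longrightarrow> act (m g h) x = act g (act h x)"
    and bij: "\<And>h. h \<in> G \<Longrightarrow> bij_betw (\<lambda>g. m g h) G G"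
  shows "(\<Sum>g\<in>G. card {x \<in> X. act g x = x}) = card G * card ((\<lambda>x. (\<lambda>g. act g x) ` G) ` X)"
proof -
  define orb where "orb x = (\<lambda>g. act g x) ` G" for x
  have orb_eq: "orb (act h x) = orb x" if "h \<in> G" "x \<in> X" for h x
  proof -
    have "orb (act h x) = (\<lambda>g. act (m g h) x) ` G"
      unfolding orb_def by (rule image_cong) (simp_all add: mult that)
    also have "\<dots> = (\<lambda>g. act g x) ` ((\<lambda>g. m g h) ` G)"
      by (simp add: image_image)
    also have "(\<lambda>g. m g h) ` G = G"
      using bij[OF that(1)] by (simp add: bij_betw_def)
    finally show ?thesis by (simp add: orb_def)
  qed
  have self: "x \<in> orb x" if "x \<in> X" for x
    unfolding orb_def using one(1) one(2)[OF that] by force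
  have fibre: "{x \<in> X. orb x = orb y} = orb y" if "y \<in> X" for y
  proof (intro equalityI subsetI)
    fix x assume "x \<in> {x \<in> X. orb x = orb y}"
    then show "x \<in> orb y" using self[of x] by simp
  next
    fix x assume "x \<in> orb y"
    then obtain g where "g \<in> G" "x = act g y" by (auto simp: orb_def)
    then show "x \<in> {x \<in> X. orb x = orb y}"
      using closed orb_eq that by simp
  qed
  \<comment> \<open>With \<open>x = act h y\<close>, right translation by \<open>h\<close> carries
    the stabilizer of \<open>x\<close> onto the set of all \<open>g\<close> that take
    \<open>y\<close> to \<open>x\<close>.\<close>
  have stab: "card {g \<in> G. act g x = x} = card {g \<in> G. act g y = x}"
    if y: "y \<in> X" and "x \<in> orb y" for x y
  proof -
    obtain h where h: "h \<in> G" "x = act h y" using \<open>x \<in> orb y\<close> by (auto simp: orb_def)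
    have inj: "inj_on (\<lambda>g. m g h) G" and img: "(\<lambda>g. m g h) ` G = G"
      using bij[OF h(1)] by (simp_all add: bij_betw_def)
    have eq: "act (m g h) y = act g x" if "g \<in> G" for g
      using mult[OF that h(1) y] h(2) by simp
    have "(\<lambda>g. m g h) ` {g \<in> G. act g x = x} = {g \<in> G. act g y = x}"
    proof (intro equalityI subsetI)
      fix k assume "k \<in> (\<lambda>g. m g h) ` {g \<in> G. act g x = x}"
      then show "k \<in> {g \<in> G. act g y = x}" using img eq by auto
    next
      fix k assume k: "k \<in> {g \<in> G. act g y = x}"
      then have "k \<in> (\<lambda>g. m g h) ` G" using img by simp
      then obtain g where "g \<in> G" "k = m g h" by blast
      then show "k \<in> (\<lambda>g. m g h) ` {g \<in> G. act g x = x}" using k eq by auto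
    qed
    moreover have "inj_on (\<lambda>g. m g h) {g \<in> G. act g x = x}"
      using inj by (rule inj_on_subset) auto
    ultimately show ?thesis by (metis (lifting) card_image)
  qed
  \<comment> \<open>The sets of all \<open>g\<close> taking \<open>y\<close> to \<open>x\<close>,
    for \<open>x\<close> in the orbit of \<open>y\<close>, partition \<open>G\<close>.\<close>
  have orbit: "(\<Sum>x \<in> orb y. card {g \<in> G. act g x = x}) = card G" if "y \<in> X" for y
  proof -
    have "(\<Sum>x \<in> orb y. card {g \<in> G. act g x = x}) = (\<Sum>x \<in> orb y. card {g \<in> G. act g y = x})"
      by (rule sum.cong) (simp_all add: stab that)
    also have "\<dots> = card G"
      using sum.image_gen[OF \<open>finite G\<close>, of "\<lambda>_. 1 :: nat" "\<lambda>g. act g y"]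
      by (simp add: orb_def)
    finally show ?thesis .
  qed
  have "(\<Sum>g\<in>G. card {x \<in> X. act g x = x}) = (\<Sum>g\<in>G. \<Sum>x\<in>X. if act g x = x then 1 else 0)"
    using \<open>finite X\<close> by (simp add: sum.If_cases Int_def)
  also have "\<dots> = (\<Sum>x\<in>X. \<Sum>g\<in>G. if act g x = x then 1 else 0)"
    by (rule sum.swap)
  also have "\<dots> = (\<Sum>x\<in>X. card {g \<in> G. act g x = x})"
    using \<open>finite G\<close> by (simp add: sum.If_cases Int_def)
  also have "\<dots> = (\<Sum>B\<in>orb ` X. \<Sum>x\<in>{x \<in> X. orb x = B}. card {g \<in> G. act g x = x})"
    by (rule sum.image_gen) fact
  also have "\<dots> = (\<Sum>B\<in>orb ` X. card G)"
    by (rule sum.cong) (auto simp: fibre orbit)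
  finally show ?thesis by (simp add: orb_def mult.commute)
qed

section \<open>Dihedral action on cyclic words\<close>

text \<open>Reading a word as a periodic function on the integers makes the wrap-around disappear:
  rotations and reflections become affine substitutions. The function \<open>of_cyc\<close> goes
  back by listing the values on one period.\<close>

definition cyc :: "'a list \<Rightarrow> int \<Rightarrow> 'a" where
  "cyc u i = u ! nat (i mod int (length u))"

definition of_cyc :: "nat \<Rightarrow> (int \<Rightarrow> 'a) \<Rightarrow> 'a list" where
  "of_cyc n h = map (\<lambda>i. h (int i)) [0..<n]"

lemma length_of_cyc [simp]: "length (of_cyc n h) = n"
  by (simp add: of_cyc_def)

lemma cyc_of_cyc:
  assumes "n > 0" "\<And>i. h (i mod int n) = h i"
  shows "cyc (of_cyc n h) i = h i"
proof -
  have "nat (i mod int n) < n" using assms(1) by (simp add: nat_less_iff)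
  then show ?thesis using assms by (simp add: cyc_def of_cyc_def)
qed

lemma nth_eq_cyc: "i < length u \<Longrightarrow> u ! i = cyc u (int i)"
  by (simp add: cyc_def flip: zmod_int)

lemma cyc_eqI:
  assumes "length u = length v" "\<And>i. cyc u i = cyc v i"
  shows "u = v"
  using assms by (intro nth_equalityI) (simp_all add: nth_eq_cyc)

lemma cyc_cong: "[i = j] (mod int (length u)) \<Longrightarrow> cyc u i = cyc u j"
  by (simp add: cyc_def cong_def)

lemma cyc_mod [simp]: "length u = n \<Longrightarrow> cyc u (i mod int n) = cyc u i"
  by (simp add: cyc_def)

text \<open>The pair \<open>(s, c)\<close> stands for the map \<open>i \<mapsto> s i + c\<close> on positions. Pairs are kept apart even if
  they induce the same map, which happens for \<open>n \<le> 2\<close>; the count of orbits needs all \<open>2 n\<close> of them.\<close>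

definition dihedral :: "nat \<Rightarrow> (int \<times> int) set" where
  "dihedral n = {1, -1} \<times> {0..<int n}"

definition dih :: "int \<times> int \<Rightarrow> 'a list \<Rightarrow> 'a list" where
  "dih g u = of_cyc (length u) (\<lambda>i. cyc u (fst g * i + snd g))"

lemma length_dih [simp]: "length (dih g u) = length u"
  by (simp add: dih_def)

lemma cyc_dih: "u \<noteq> [] \<Longrightarrow> cyc (dih g u) i = cyc u (fst g * i + snd g)"
  unfolding dih_def
  by (rule cyc_of_cyc, simp, rule cyc_cong)
    (intro cong_add cong_scalar_left cong_refl, simp add: cong_def)

text \<open>A word is read at the image of a position, so in \<open>dih g (dih h u)\<close> the
  position map of \<open>g\<close> is applied before that of \<open>h\<close>. This is why
  \<open>snd g\<close> is multiplied by \<open>fst h\<close>.\<close>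

definition dih_mult :: "nat \<Rightarrow> int \<times> int \<Rightarrow> int \<times> int \<Rightarrow> int \<times> int" where
  "dih_mult n g h = (fst g * fst h, (fst h * snd g + snd h) mod int n)"

lemma finite_dihedral [simp]: "finite (dihedral n)"
  by (simp add: dihedral_def)

lemma card_dihedral: "card (dihedral n) = 2 * n"
  by (simp add: dihedral_def card_cartesian_product)

lemma dih_dih_mult: "u \<noteq> [] \<Longrightarrow> dih (dih_mult (length u) g h) u = dih g (dih h u)"
proof (rule cyc_eqI)
  fix i assume u: "u \<noteq> []"
  then have ne: "dih h u \<noteq> []" using length_dih[of h u] by force
  show "cyc (dih (dih_mult (length u) g h) u) i = cyc (dih g (dih h u)) i"
    unfolding cyc_dih[OF u] cyc_dih[OF ne]
  proof (rule cyc_cong)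
    have "[fst g * fst h * i + (fst h * snd g + snd h) mod int (length u) =
        fst g * fst h * i + (fst h * snd g + snd h)] (mod int (length u))"
      by (intro cong_add cong_refl) (simp add: cong_def)
    then show "[fst (dih_mult (length u) g h) * i + snd (dih_mult (length u) g h) =
        fst h * (fst g * i + snd g) + snd h] (mod int (length u))"
      by (simp add: dih_mult_def algebra_simps)
  qed
qed simp

text \<open>This takes the place of inverses in the orbit count: signs are units, so right
  translation is injective, and it is onto by finiteness.\<close>

lemma bij_betw_dih_mult:
  assumes h: "h \<in> dihedral n"
  shows "bij_betw (\<lambda>g. dih_mult n g h) (dihedral n) (dihedral n)"
  unfolding bij_betw_def
proof
  have "(\<lambda>g. dih_mult n g h) ` dihedral n \<subseteq> dihedral n"
    using h by (auto simp: dihedral_def dih_mult_def)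
  moreover show inj: "inj_on (\<lambda>g. dih_mult n g h) (dihedral n)"
  proof (rule inj_onI)
    fix g g' assume g: "g \<in> dihedral n" "g' \<in> dihedral n" and eq: "dih_mult n g h = dih_mult n g' h"
    from eq have "[fst h * snd g + snd h = fst h * snd g' + snd h] (mod int n)"
      by (simp add: dih_mult_def cong_def)
    then have "[fst h * snd g = fst h * snd g'] (mod int n)"
      by (simp add: cong_add_rcancel)
    then have "[snd g = snd g'] (mod int n)"
      using h by (auto simp: dihedral_def cong_minus_minus_iff)
    then have "snd g = snd g'"
      using g by (auto simp: dihedral_def cong_def)
    moreover have "fst g = fst g'"
      using eq h by (auto simp: dih_mult_def dihedral_def)
    ultimately show "g = g'" by (rule prod_eqI[rotated])
  qed
  ultimately show "(\<lambda>g. dih_mult n g h) ` dihedral n = dihedral n"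
    by (intro endo_inj_surj) simp_all
qed

text \<open>The condition on the first and last letters is the no-11 condition for the pair that
  wraps around. For \<open>n = 1\<close> the positions \<open>i\<close> and \<open>i + 1\<close>
  coincide on the cycle, which excludes the string 1.\<close>

lemma lucas_strings_iff_cyc:
  assumes "n > 0"
  shows "u \<in> lucas_strings n \<longleftrightarrow> length u = n \<and> (\<forall>i. \<not> (cyc u i \<and> cyc u (i + 1)))"
proof (cases "length u = n")
  case len: True
  have cyc_range: "(\<forall>i. \<not> (cyc u i \<and> cyc u (i + 1))) \<longleftrightarrow> (\<forall>i<n. \<not> (cyc u (int i) \<and> cyc u (int i + 1)))"
  proof (intro iffI allI)
    fix i assume *: "\<forall>i<n. \<not> (cyc u (int i) \<and> cyc u (int i + 1))"
    have "nat (i mod int n) < n" using assms by (simp add: nat_less_iff)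
    with * have "\<not> (cyc u (i mod int n) \<and> cyc u (i mod int n + 1))"
      using assms by fastforce
    moreover have "cyc u (i mod int n + 1) = cyc u (i + 1)"
      by (rule cyc_cong) (simp add: len cong_def mod_simps)
    ultimately show "\<not> (cyc u i \<and> cyc u (i + 1))"
      using len by simp
  qed simp
  have next_eq: "cyc u (int i + 1) = (if Suc i < n then u ! Suc i else u ! 0)" if "i < n" for i
  proof (cases "Suc i < n")
    case True
    then show ?thesis using nth_eq_cyc[of "Suc i" u] len by (simp add: add.commute)
  next
    case False
    with that have "int i + 1 = int n" by linarith
    then show ?thesis using False len by (simp add: cyc_def)
  qed
  have "(\<forall>i<n. \<not> (cyc u (int i) \<and> cyc u (int i + 1))) \<longleftrightarrow>
      (\<forall>i. Suc i < n \<longrightarrow> \<not> (u ! i \<and> u ! Suc i)) \<and> \<not> (u ! 0 \<and> u ! (n - 1))" (is "?L \<longleftrightarrow> ?R")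
  proof
    assume L: ?L
    have "\<not> (u ! i \<and> u ! Suc i)" if "Suc i < n" for i
      using L[rule_format, of i] that next_eq[of i] nth_eq_cyc[of i u] len by simp
    moreover have "\<not> (u ! 0 \<and> u ! (n - 1))"
      using L[rule_format, of "n - 1"] assms next_eq[of "n - 1"] nth_eq_cyc[of "n - 1" u] len by auto
    ultimately show ?R by blast
  next
    assume R: ?R
    show ?L
    proof (intro allI impI)
      fix i assume i: "i < n"
      show "\<not> (cyc u (int i) \<and> cyc u (int i + 1))"
      proof (cases "Suc i < n")
        case True
        then show ?thesis using R i next_eq[OF i] nth_eq_cyc[of i u] len by simp
      next
        case False
        then have "i = n - 1" using i by simp
        then show ?thesis using R i next_eq[OF i] nth_eq_cyc[of i u] len by auto
      qed
    qed
  qed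
  then show ?thesis
    using len assms cyc_range by (simp add: lucas_strings_def binary_strings_def)
next
  case False
  then show ?thesis by (simp add: lucas_strings_def binary_strings_def)
qed

lemma finite_lucas_strings [simp]: "finite (lucas_strings n)"
  using finite_lists_length_eq[of "UNIV :: bool set" n]
  by (simp add: lucas_strings_def binary_strings_def)

lemma dih_in_lucas_strings:
  assumes "n > 0" "fst g \<in> {1, -1}" "u \<in> lucas_strings n"
  shows "dih g u \<in> lucas_strings n"
proof -
  have u: "length u = n" "u \<noteq> []" "\<And>i. \<not> (cyc u i \<and> cyc u (i + 1))"
    using assms by (auto simp: lucas_strings_iff_cyc)
  have "\<not> (cyc (dih g u) i \<and> cyc (dih g u) (i + 1))" for i
  proof -
    have "fst g = 1 \<or> fst g = -1" using assms(2) by simp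
    then show ?thesis
      \<comment> \<open>The second instance serves reflections: there the positions \<open>i\<close>
        and \<open>i + 1\<close> are read at an adjacent pair in reversed order.\<close>
      using u(3)[of "i + snd g"] u(3)[of "- i - 1 + snd g"]
      by (auto simp: cyc_dih[OF u(2)] algebra_simps)
  qed
  then show ?thesis using assms(1) u(1) by (simp add: lucas_strings_iff_cyc)
qed

lemma dih_one: "u \<noteq> [] \<Longrightarrow> dih (1, 0) u = u"
  by (rule cyc_eqI) (simp_all add: cyc_dih)

lemma sum_dihedral_fixed:
  assumes "n > 0"
  shows "(\<Sum>g\<in>dihedral n. card {u \<in> lucas_strings n. dih g u = u}) =
    2 * n * card ((\<lambda>u. (\<lambda>g. dih g u) ` dihedral n) ` lucas_strings n)"
proof -
  have len: "length u = n" "u \<noteq> []" if "u \<in> lucas_strings n" for u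
    using that assms by (auto simp: lucas_strings_iff_cyc)
  have "(1, 0) \<in> dihedral n" using assms by (simp add: dihedral_def)
  moreover have "fst g \<in> {1, -1}" if "g \<in> dihedral n" for g
    using that by (auto simp: dihedral_def)
  ultimately show ?thesis
    unfolding card_dihedral[symmetric]
    by (intro sum_card_fixed_points[where e = "(1, 0)" and m = "dih_mult n"])
      (use assms len in \<open>auto simp: dih_in_lucas_strings bij_betw_dih_mult dih_one
        simp flip: dih_dih_mult\<close>)
qed

section \<open>Strings fixed by rotations\<close>

text \<open>A word \<open>w\<close> such that \<open>a w b\<close> has no two adjacent \<open>1\<close>s; a boundary letter \<open>1\<close> thus forces
  the adjacent letter of \<open>w\<close> to be \<open>0\<close>, and a boundary letter \<open>0\<close> imposes nothing.\<close>

definition walks :: "nat \<Rightarrow> bool \<Rightarrow> bool \<Rightarrow> bool list set" where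
  "walks m a b = {w. length w = m \<and> successively (\<lambda>x y. \<not> (x \<and> y)) (a # w @ [b])}"

lemma finite_walks [simp]: "finite (walks m a b)"
  by (rule finite_subset[OF _ finite_lists_length_eq[of "UNIV :: bool set" m]])
    (auto simp: walks_def)

lemma walks_0: "walks 0 a b = (if a \<and> b then {} else {[]})"
  by (auto simp: walks_def)

lemma walks_Suc_True: "walks (Suc m) True b = Cons False ` walks m False b"
  by (auto simp: walks_def length_Suc_conv image_iff)

lemma walks_Suc_False:
  "walks (Suc m) False b = Cons False ` walks m False b \<union> Cons True ` walks m True b"
proof -
  have "walks (Suc m) False b = (\<Union>c. Cons c ` walks m c b)"
    by (auto simp: walks_def length_Suc_conv image_iff)
  then show ?thesis by (simp add: UNIV_bool Un_commute)
qed

text \<open>Deleting the first letter makes it the new left boundary, so the four counts are proved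
  together. A left boundary 0 leaves the first letter free, which gives the Fibonacci recursion; a
  boundary 1 forces a 0.\<close>

lemma card_walks:
  "card (walks m False False) = fib (m + 2)" "card (walks m False True) = fib (m + 1)"
  "card (walks m True False) = fib (m + 1)" "card (walks m True True) = fib m"
proof (induction m)
  case 0
  show "card (walks 0 False False) = fib (0 + 2)" "card (walks 0 False True) = fib (0 + 1)"
    "card (walks 0 True False) = fib (0 + 1)" "card (walks 0 True True) = fib 0"
    by (simp_all add: walks_0)
next
  case (Suc m)
  have "card (walks (Suc m) False b) = card (walks m False b) + card (walks m True b)" for b
    unfolding walks_Suc_False by (subst card_Un_disjoint) (auto simp: card_image)
  moreover have "card (walks (Suc m) True b) = card (walks m False b)" for b
    unfolding walks_Suc_True by (simp add: card_image)
  ultimately show "card (walks (Suc m) False False) = fib (Suc m + 2)"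
    "card (walks (Suc m) False True) = fib (Suc m + 1)"
    "card (walks (Suc m) True False) = fib (Suc m + 1)"
    "card (walks (Suc m) True True) = fib (Suc m)"
    using Suc.IH by simp_all
qed

section \<open>Lucas strings as linear words, and their number\<close>

lemma successively_iff_nth:
  "successively P xs \<longleftrightarrow> (\<forall>i. Suc i < length xs \<longrightarrow> P (xs ! i) (xs ! Suc i))"
proof (induction P xs rule: successively.induct)
  case (3 P x y xs)
  have "successively P (x # y # xs) \<longleftrightarrow>
      P x y \<and> (\<forall>i. Suc i < length (y # xs) \<longrightarrow> P ((y # xs) ! i) ((y # xs) ! Suc i))"
    using 3 by simp
  also have "\<dots> \<longleftrightarrow> (\<forall>i. Suc i < length (x # y # xs) \<longrightarrow>
      P ((x # y # xs) ! i) ((x # y # xs) ! Suc i))"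
    by (auto simp: All_less_Suc2 nth_Cons split: nat.splits)
  finally show ?case .
qed simp_all

lemma lucas_strings_iff_successively:
  assumes "n > 0"
  shows "u \<in> lucas_strings n \<longleftrightarrow>
    length u = n \<and> successively (\<lambda>x y. \<not> (x \<and> y)) u \<and> \<not> (hd u \<and> last u)"
proof (cases "length u = n")
  case True
  then have "u \<noteq> []" using assms by auto
  then show ?thesis
    using True assms
    by (simp add: lucas_strings_def binary_strings_def successively_iff_nth hd_conv_nth last_conv_nth)
next
  case False
  then show ?thesis by (simp add: lucas_strings_def binary_strings_def)
qed

lemma lucas_Suc_eq_fib: "lucas (Suc m) = fib (m + 2) + fib m"
  by (induction m rule: fib.induct) simp_all

text \<open>The cycle is cut at its first letter \<open>c\<close>; the remaining
  \<open>n - 1\<close> letters form a walk from \<open>c\<close> back to \<open>c\<close>.\<close>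

lemma card_lucas_strings:
  assumes "n > 0"
  shows "card (lucas_strings n) = lucas n"
proof -
  obtain m where n: "n = Suc m" using assms gr0_conv_Suc by blast
  have "u \<in> lucas_strings n \<longleftrightarrow> (\<exists>c. u \<in> Cons c ` walks m c c)" for u
  proof (cases u)
    case Nil
    then show ?thesis using n by (auto simp: lucas_strings_def binary_strings_def)
  next
    case (Cons c w)
    have "u \<in> lucas_strings n \<longleftrightarrow> w \<in> walks m c c"
      using Cons n by (auto simp: lucas_strings_iff_successively walks_def successively_append_iff
          simp flip: append_Cons)
    then show ?thesis using Cons by auto
  qed
  then have "lucas_strings n = Cons False ` walks m False False \<union> Cons True ` walks m True True"
    by (auto, metis (full_types) imageI)
  then have "card (lucas_strings n) = card (walks m False False) + card (walks m True True)"
    by (simp, subst card_Un_disjoint) (auto simp: card_image)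
  then show ?thesis by (simp add: card_walks n lucas_Suc_eq_fib)
qed

lemma periodic_cong:
  fixes f :: "int \<Rightarrow> 'a"
  assumes "\<And>i. f (i + d) = f i" "[i = j] (mod d)"
  shows "f i = f j"
proof -
  have *: "f (i + int k * d) = f i" for i k
    by (induction k) (simp_all add: algebra_simps, metis assms(1) add.assoc add.commute)
  have **: "f (i + k * d) = f i" for i k
  proof (cases "k \<ge> 0")
    case True
    then show ?thesis using *[of i "nat k"] by simp
  next
    case False
    then show ?thesis using *[of "i + k * d" "nat (- k)"] by simp
  qed
  obtain k where "j = i + d * k" using assms(2) by (metis cong_iff_lin)
  then show ?thesis using **[of i k] by (simp add: mult.commute)
qed

lemma dih_eq_iff:
  assumes "u \<noteq> []"
  shows "dih g u = u \<longleftrightarrow> (\<forall>i. cyc u (fst g * i + snd g) = cyc u i)"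
  by (metis assms cyc_dih cyc_eqI length_dih)

text \<open>A string invariant under the shift by \<open>c\<close> has period
  \<open>d = gcd c n\<close>, so it repeats one block of length \<open>d\<close>. Since the Lucas
  condition is cyclic and local, the string satisfies it iff the block does, even for
  \<open>d = 1\<close>.\<close>

lemma card_rotation_fixed:
  assumes n: "n > 0"
  shows "card {u \<in> lucas_strings n. dih (1, int c) u = u} = lucas (gcd c n)"
proof -
  define d where "d = gcd c n"
  have d: "d > 0" "d dvd n" "d dvd c" using n by (simp_all add: d_def)
  have shift: "dih (1, int c) u = u \<longleftrightarrow> (\<forall>i. cyc u (i + int d) = cyc u i)" if len: "length u = n" for u :: "bool list"
  proof -
    have ne: "u \<noteq> []" using len n by auto
    show ?thesis
      unfolding dih_eq_iff[OF ne]
    proof (rule iffI; rule allI)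
      fix i assume per: "\<forall>i. cyc u (fst (1, int c) * i + snd (1, int c)) = cyc u i"
      \<comment> \<open>In this Bezout identity the multiple of \<open>n\<close> is absorbed by
        cyclicity and the multiple of \<open>c\<close> by the assumed invariance.\<close>
      obtain x y where xy: "x * int c + y * int n = int d"
        using bezout_int[of "int c" "int n"] by (auto simp: d_def)
      have "cyc u (i + int d) = cyc u (i + x * int c)"
        by (rule cyc_cong) (simp add: len cong_iff_dvd_diff flip: xy)
      also have "\<dots> = cyc u i"
        by (rule periodic_cong[where d = "int c"]) (use per in \<open>simp_all add: cong_def\<close>)
      finally show "cyc u (i + int d) = cyc u i" .
    next
      fix i assume per: "\<forall>i. cyc u (i + int d) = cyc u i"
      have "cyc u (i + int c) = cyc u i"
        by (rule periodic_cong[where d = "int d"]) (use per d in \<open>auto simp: cong_iff_dvd_diff\<close>)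
      then show "cyc u (fst (1, int c) * i + snd (1, int c)) = cyc u i" by simp
    qed
  qed
  have down: "cyc (of_cyc d (cyc u)) i = cyc u i" if "\<forall>i. cyc u (i + int d) = cyc u i"
    for u :: "bool list" and i
  proof (rule cyc_of_cyc[OF d(1)])
    show "cyc u (i mod int d) = cyc u i" for i
      by (rule periodic_cong[where d = "int d"]) (use that in \<open>simp_all add: cong_def\<close>)
  qed
  have up: "cyc (of_cyc n (cyc v)) i = cyc v i" if "length v = d" for v :: "bool list" and i
  proof (rule cyc_of_cyc[OF n])
    show "cyc v (i mod int n) = cyc v i" for i
      by (rule cyc_cong) (use that d in \<open>simp add: cong_def mod_mod_cancel\<close>)
  qed
  have per: "cyc v (i + int d) = cyc v i" if "length v = d" for v :: "bool list" and i
    by (rule cyc_cong) (simp add: that cong_def)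
  have "bij_betw (\<lambda>u. of_cyc d (cyc u)) {u \<in> lucas_strings n. dih (1, int c) u = u} (lucas_strings d)"
  proof (rule bij_betw_byWitness[where f' = "\<lambda>v. of_cyc n (cyc v)"])
    show "\<forall>u\<in>{u \<in> lucas_strings n. dih (1, int c) u = u}. of_cyc n (cyc (of_cyc d (cyc u))) = u"
      by (intro ballI cyc_eqI) (auto simp: lucas_strings_iff_cyc[OF n] up down shift)
    show "\<forall>v\<in>lucas_strings d. of_cyc d (cyc (of_cyc n (cyc v))) = v"
      by (intro ballI cyc_eqI) (auto simp: lucas_strings_iff_cyc[OF d(1)] up down per)
    show "(\<lambda>u. of_cyc d (cyc u)) ` {u \<in> lucas_strings n. dih (1, int c) u = u} \<subseteq> lucas_strings d"
      by (auto simp: lucas_strings_iff_cyc[OF n] lucas_strings_iff_cyc[OF d(1)] down shift)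
    show "(\<lambda>v. of_cyc n (cyc v)) ` lucas_strings d \<subseteq> {u \<in> lucas_strings n. dih (1, int c) u = u}"
      by (auto simp: lucas_strings_iff_cyc[OF n] lucas_strings_iff_cyc[OF d(1)] up shift per)
  qed
  from bij_betw_same_card[OF this] show ?thesis
    unfolding card_lucas_strings[OF d(1)] by (simp add: d_def)
qed

text \<open>The terms are grouped by the value \<open>d\<close> of the gcd, which is attained
  \<open>totient (n div d)\<close> times.\<close>

lemma sum_gcd_eq_sum_totient:
  assumes n: "n > 0"
  shows "(\<Sum>c<n. h (gcd c n)) = (\<Sum>d | d dvd n. totient (n div d) * h d :: nat)"
proof -
  obtain m where m: "n = Suc m" using n gr0_conv_Suc by blast
  \<comment> \<open>The term at 0 is traded for the term at \<open>n\<close>, as both have gcd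
    \<open>n\<close>; the totient count is available on the range from 1 to
    \<open>n\<close>.\<close>
  have "(\<Sum>c<n. h (gcd c n)) = (\<Sum>c<n. h (gcd (Suc c) n))"
    using sum.lessThan_Suc_shift[of "\<lambda>c. h (gcd c n)" m]
      sum.lessThan_Suc[of "\<lambda>c. h (gcd (Suc c) n)" m] by (simp add: m)
  also have "\<dots> = (\<Sum>k\<in>{0<..n}. h (gcd k n))"
    by (rule sum.reindex_bij_witness[of _ "\<lambda>k. k - 1" Suc]) auto
  also have "\<dots> = (\<Sum>d | d dvd n. \<Sum>k\<in>{k \<in> {0<..n}. gcd k n = d}. h (gcd k n))"
    by (rule sum.group[symmetric]) (use n in auto)
  also have "\<dots> = (\<Sum>d | d dvd n. totient (n div d) * h d)"
    using n by (intro sum.cong) (auto simp flip: card_gcd_eq_totient)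
  finally show ?thesis .
qed

section \<open>Strings fixed by reflections\<close>

definition reflection_fixed :: "nat \<Rightarrow> int \<Rightarrow> bool list set" where
  "reflection_fixed n c = {u \<in> lucas_strings n. \<forall>i. cyc u (c - i) = cyc u i}"

lemma finite_reflection_fixed [simp]: "finite (reflection_fixed n c)"
  by (simp add: reflection_fixed_def)

lemma dih_reflection_fixed:
  assumes "n > 0"
  shows "{u \<in> lucas_strings n. dih (-1, c) u = u} = reflection_fixed n c"
proof -
  have "u \<noteq> []" if "u \<in> lucas_strings n" for u
    using that assms by (auto simp: lucas_strings_iff_cyc)
  then show ?thesis
    by (auto simp: reflection_fixed_def dih_eq_iff)
qed

text \<open>Rotation by \<open>t\<close> conjugates the reflection
  \<open>i \<mapsto> c + 2 * t - i\<close> to \<open>i \<mapsto> c - i\<close>. The reverse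
  inequality is the same one for \<open>-t\<close>, so only the representatives
  \<open>c = -1\<close> and \<open>c = 0\<close> have to be counted.\<close>

lemma card_reflection_fixed_le:
  assumes n: "n > 0"
  shows "card (reflection_fixed n (c + 2 * t)) \<le> card (reflection_fixed n c)"
proof (rule card_inj_on_le)
  have ne: "u \<noteq> []" "length u = n" if "u \<in> reflection_fixed n (c + 2 * t)" for u
    using that n by (auto simp: reflection_fixed_def lucas_strings_iff_cyc)
  show "inj_on (dih (1, t)) (reflection_fixed n (c + 2 * t))"
  proof (rule inj_onI)
    fix u v assume uv: "u \<in> reflection_fixed n (c + 2 * t)" "v \<in> reflection_fixed n (c + 2 * t)"
      "dih (1, t) u = dih (1, t) v"
    have "cyc (dih (1, t) u) j = cyc (dih (1, t) v) j" for j
      by (simp only: uv(3))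
    then have "cyc u (j + t) = cyc v (j + t)" for j
      by (simp add: cyc_dih ne uv(1,2))
    from this[of "i - t" for i] show "u = v"
      using uv by (intro cyc_eqI) (simp_all add: ne)
  qed
  show "dih (1, t) ` reflection_fixed n (c + 2 * t) \<subseteq> reflection_fixed n c"
  proof (rule image_subsetI)
    fix u assume u: "u \<in> reflection_fixed n (c + 2 * t)"
    then have "cyc u (c + 2 * t - (i + t)) = cyc u (i + t)" for i
      by (simp only: reflection_fixed_def mem_Collect_eq)
    moreover have "c + 2 * t - (i + t) = c - i + t" for i by simp
    ultimately have "cyc u (c - i + t) = cyc u (i + t)" for i by metis
    then show "dih (1, t) u \<in> reflection_fixed n c"
      using u ne[OF u] n by (simp add: reflection_fixed_def dih_in_lucas_strings cyc_dih)
  qed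
qed simp

lemma card_reflection_fixed_shift:
  assumes "n > 0"
  shows "card (reflection_fixed n (c + 2 * t)) = card (reflection_fixed n c)"
  using card_reflection_fixed_le[OF assms, of c t] card_reflection_fixed_le[OF assms, of "c + 2 * t" "-t"]
  by simp

lemma reflection_fixed_cong:
  assumes n: "n > 0" and "[c = d] (mod int n)"
  shows "reflection_fixed n c = reflection_fixed n d"
proof -
  have "cyc u (c - i) = cyc u (d - i)" if "u \<in> lucas_strings n" for u i
    using that assms by (intro cyc_cong cong_diff cong_refl) (simp add: lucas_strings_iff_cyc)
  then show ?thesis by (auto simp: reflection_fixed_def)
qed

section \<open>The two representative reflections and their palindromes\<close>

lemma cyc_rev: "u \<noteq> [] \<Longrightarrow> cyc (rev u) i = cyc u (- 1 - i)"
proof -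
  assume u: "u \<noteq> []"
  define n where "n = length u"
  define k where "k = nat (i mod int n)"
  have n: "n > 0" using u by (simp add: n_def)
  then have k: "k < n" "i mod int n = int k" by (simp_all add: k_def nat_less_iff)
  \<comment> \<open>Division of \<open>i\<close> by \<open>n\<close> with remainder \<open>k\<close>
    shows that \<open>- 1 - i\<close> has residue \<open>n - 1 - k\<close>, the place that list
    reversal reads.\<close>
  have "- 1 - i - int (n - Suc k) = int n * (- 1 - i div int n)"
    using k mult_div_mod_eq[of "int n" i] by (simp add: algebra_simps)
  then have "[- 1 - i = int (n - Suc k)] (mod int n)"
    by (simp add: cong_iff_dvd_diff)
  then have "(- 1 - i) mod int n = int (n - Suc k) mod int n"
    by (simp only: cong_def)
  also have "\<dots> = int (n - Suc k)"
    using n by (intro mod_pos_pos_trivial) simp_all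
  finally have "nat ((- 1 - i) mod int n) = n - Suc k" by (simp only: nat_int)
  then show ?thesis using k by (simp add: cyc_def rev_nth flip: n_def)
qed

lemma reflection_fixed_minus_one:
  assumes "n > 0"
  shows "reflection_fixed n (-1) = {u \<in> lucas_strings n. rev u = u}"
proof -
  have "(\<forall>i. cyc u (- 1 - i) = cyc u i) \<longleftrightarrow> rev u = u" if "u \<in> lucas_strings n" for u
  proof -
    have "u \<noteq> []" using that assms by (auto simp: lucas_strings_iff_cyc)
    then show ?thesis by (auto simp: cyc_rev[symmetric] intro: cyc_eqI)
  qed
  then show ?thesis by (auto simp: reflection_fixed_def)
qed

text \<open>The reflection with \<open>c = 0\<close> has position 0 on its axis: it keeps the first
  letter and reverses the rest of the list.\<close>

lemma cyc_Cons_rev: "cyc (x # rev v) i = cyc (x # v) (- i)"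
proof -
  define n where "n = Suc (length v)"
  define k where "k = nat (i mod int n)"
  have "n > 0" by (simp add: n_def)
  then have k: "k < n" "i mod int n = int k" by (simp_all add: k_def nat_less_iff)
  show ?thesis
  proof (cases "k = 0")
    case True
    then have "(- i) mod int n = 0" using k by (simp add: zmod_zminus1_eq_if)
    then show ?thesis using True k by (simp add: cyc_def flip: n_def)
  next
    case False
    then obtain l where l: "k = Suc l" by (cases k) auto
    have "(- i) mod int n = int (n - k)"
      using k False by (simp add: zmod_zminus1_eq_if)
    moreover have "n - k = Suc (length v - Suc l)" using k l by (simp add: n_def)
    ultimately have "nat ((- i) mod int n) = Suc (length v - Suc l)" "nat (i mod int n) = Suc l"
      using k l by simp_all
    moreover have "l < length v" using k l by (simp add: n_def)
    ultimately show ?thesis by (simp add: cyc_def rev_nth flip: n_def)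
  qed
qed

lemma palindrome_even:
  assumes "length v = 2 * m" "rev v = v"
  obtains w where "length w = m" "v = w @ rev w"
proof
  show "length (take m v) = m" using assms(1) by simp
  have "rev (take m v) = drop m v" using assms by (simp add: rev_take)
  then show "v = take m v @ rev (take m v)" by simp
qed

lemma palindrome_odd:
  assumes "length v = Suc (2 * m)" "rev v = v"
  obtains w y where "length w = m" "v = w @ y # rev w"
proof
  show "length (take m v) = m" using assms(1) by simp
  have "rev (take m v) = drop (Suc m) v" using assms by (simp add: rev_take)
  moreover have "v = take m v @ v ! m # drop (Suc m) v"
    using assms(1) by (intro id_take_nth_drop) simp
  ultimately show "v = take m v @ v ! m # rev (take m v)" by simp
qed

text \<open>Reversing a word swaps the arguments of the relation in \<open>successively\<close>. The
  no-11 relation is symmetric, and this rule brings its mirrored implication back to a single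
  form.\<close>

lemma successively_no11_commute:
  "successively (\<lambda>x y. y \<longrightarrow> \<not> x) w = successively (\<lambda>x y. x \<longrightarrow> \<not> y) w"
  by (rule successively_cong) auto

text \<open>The axis passes between positions at both ends. In \<open>w @ rev w\<close> the two
  middle letters are equal and adjacent, as are the two outer letters on the cycle, so all four are
  0; this is the effect of two boundary letters 1 on \<open>w\<close>.\<close>

lemma card_reflection_fixed_even_minus_one:
  assumes "m > 0"
  shows "card (reflection_fixed (2 * m) (-1)) = fib m"
proof -
  have "u \<in> reflection_fixed (2 * m) (-1) \<longleftrightarrow> u \<in> (\<lambda>w. w @ rev w) ` walks m True True" for u
  proof -
    have *: "w @ rev w \<in> lucas_strings (2 * m) \<longleftrightarrow> w \<in> walks m True True" if "length w = m" for w
      using that assms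
      by (cases w) (auto simp: lucas_strings_iff_successively walks_def successively_append_iff
          successively_Cons successively_no11_commute hd_append last_rev hd_rev)
    have "u \<in> lucas_strings (2 * m) \<and> rev u = u \<longleftrightarrow>
        (\<exists>w. length w = m \<and> u = w @ rev w \<and> w \<in> walks m True True)"
    proof
      assume u: "u \<in> lucas_strings (2 * m) \<and> rev u = u"
      then have "length u = 2 * m" using assms by (simp add: lucas_strings_iff_cyc)
      with u obtain w where "length w = m" "u = w @ rev w" by (auto elim: palindrome_even)
      then show "\<exists>w. length w = m \<and> u = w @ rev w \<and> w \<in> walks m True True"
        using u * by blast
    next
      assume "\<exists>w. length w = m \<and> u = w @ rev w \<and> w \<in> walks m True True"
      then obtain w where "length w = m" "u = w @ rev w" "w \<in> walks m True True" by blast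
      then show "u \<in> lucas_strings (2 * m) \<and> rev u = u" using * by simp
    qed
    also have "\<dots> \<longleftrightarrow> u \<in> (\<lambda>w. w @ rev w) ` walks m True True"
      by (auto simp: walks_def)
    finally show ?thesis
      using assms by (simp add: reflection_fixed_minus_one)
  qed
  then have "reflection_fixed (2 * m) (-1) = (\<lambda>w. w @ rev w) ` walks m True True" by blast
  moreover have "inj_on (\<lambda>w. w @ rev w) (walks m True True)"
    by (rule inj_onI) (simp add: walks_def)
  ultimately show ?thesis by (simp add: card_image card_walks)
qed

text \<open>The axis passes through the middle letter, which is free on its outer side, while the
  equal outer letters are adjacent on the cycle and must be 0. Hence the half word including the
  middle letter has boundaries 1 and 0.\<close>

lemma card_reflection_fixed_odd_minus_one:
  "card (reflection_fixed (Suc (2 * m)) (-1)) = fib (m + 2)"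
proof -
  let ?f = "\<lambda>z. z @ rev (butlast z) :: bool list"
  have "u \<in> reflection_fixed (Suc (2 * m)) (-1) \<longleftrightarrow> u \<in> ?f ` walks (Suc m) True False" for u
  proof -
    have *: "w @ y # rev w \<in> lucas_strings (Suc (2 * m)) \<longleftrightarrow> w @ [y] \<in> walks (Suc m) True False"
      if "length w = m" for w y
      using that
      by (cases w) (auto simp: lucas_strings_iff_successively walks_def successively_append_iff
          successively_Cons successively_no11_commute hd_append last_rev hd_rev)
    have "u \<in> ?f ` walks (Suc m) True False \<longleftrightarrow>
        (\<exists>w y. length w = m \<and> u = w @ y # rev w \<and> w @ [y] \<in> walks (Suc m) True False)"
    proof
      assume "u \<in> ?f ` walks (Suc m) True False"
      then obtain z where z: "z \<in> walks (Suc m) True False" "u = ?f z" by blast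
      then obtain w y where "z = w @ [y]" by (cases z rule: rev_cases) (auto simp: walks_def)
      with z show "\<exists>w y. length w = m \<and> u = w @ y # rev w \<and> w @ [y] \<in> walks (Suc m) True False"
        by (intro exI[of _ w] exI[of _ y]) (auto simp: walks_def)
    next
      assume "\<exists>w y. length w = m \<and> u = w @ y # rev w \<and> w @ [y] \<in> walks (Suc m) True False"
      then obtain w y where "u = w @ y # rev w" "w @ [y] \<in> walks (Suc m) True False" by blast
      then show "u \<in> ?f ` walks (Suc m) True False"
        by (intro image_eqI[of _ _ "w @ [y]"]) simp_all
    qed
    also have "\<dots> \<longleftrightarrow> u \<in> lucas_strings (Suc (2 * m)) \<and> rev u = u"
    proof
      assume u: "u \<in> lucas_strings (Suc (2 * m)) \<and> rev u = u"
      then have "length u = Suc (2 * m)" by (simp add: lucas_strings_iff_cyc)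
      with u obtain w y where "length w = m" "u = w @ y # rev w" by (auto elim: palindrome_odd)
      then show "\<exists>w y. length w = m \<and> u = w @ y # rev w \<and> w @ [y] \<in> walks (Suc m) True False"
        using u * by blast
    next
      assume "\<exists>w y. length w = m \<and> u = w @ y # rev w \<and> w @ [y] \<in> walks (Suc m) True False"
      then obtain w y where "length w = m" "u = w @ y # rev w" "w @ [y] \<in> walks (Suc m) True False"
        by blast
      then show "u \<in> lucas_strings (Suc (2 * m)) \<and> rev u = u" using * by simp
    qed
    finally show ?thesis by (simp add: reflection_fixed_minus_one)
  qed
  then have "reflection_fixed (Suc (2 * m)) (-1) = ?f ` walks (Suc m) True False" by blast
  moreover have "inj_on ?f (walks (Suc m) True False)"
    by (rule inj_onI) (simp add: walks_def)
  ultimately show ?thesis by (simp add: card_image card_walks)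
qed

text \<open>The axis passes through the positions 0 and \<open>m\<close>. The half word from 0 to
  \<open>m\<close> has \<open>m + 1\<close> letters, and reflecting it creates no new adjacent pairs
  beyond mirror images, so both boundaries are 0.\<close>

lemma card_reflection_fixed_even_zero:
  assumes "m > 0"
  shows "card (reflection_fixed (2 * m) 0) = fib (m + 3)"
proof -
  obtain k where m: "m = Suc k" using assms gr0_conv_Suc by blast
  have n: "2 * m > 0" using assms by simp
  \<comment> \<open>The first and last letters of \<open>z\<close> lie on the axis and are not
    repeated in the mirrored half.\<close>
  let ?f = "\<lambda>z. z @ rev (butlast (tl z)) :: bool list"
  let ?Q = "\<lambda>u x w y. length w = k \<and> u = x # w @ y # rev w \<and> x # w @ [y] \<in> walks (Suc m) False False"
  have "u \<in> reflection_fixed (2 * m) 0 \<longleftrightarrow> u \<in> ?f ` walks (Suc m) False False" for u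
  proof -
    have *: "x # w @ y # rev w \<in> lucas_strings (2 * m) \<longleftrightarrow> x # w @ [y] \<in> walks (Suc m) False False"
      if "length w = k" for x w y
      using that
      by (cases w) (auto simp: m lucas_strings_iff_successively walks_def successively_append_iff
          successively_Cons successively_no11_commute hd_append last_rev hd_rev)
    have pal: "(\<forall>i. cyc (x # v) (- i) = cyc (x # v) i) \<longleftrightarrow> rev v = v" for x :: bool and v
    proof
      assume "\<forall>i. cyc (x # v) (- i) = cyc (x # v) i"
      then have "x # rev v = x # v" by (intro cyc_eqI) (simp_all add: cyc_Cons_rev)
      then show "rev v = v" by simp
    next
      assume "rev v = v"
      then show "\<forall>i. cyc (x # v) (- i) = cyc (x # v) i"
        using cyc_Cons_rev[of x v] by simp
    qed
    have "u \<in> ?f ` walks (Suc m) False False \<longleftrightarrow> (\<exists>x w y. ?Q u x w y)"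
    proof
      assume "u \<in> ?f ` walks (Suc m) False False"
      then obtain z where z: "z \<in> walks (Suc m) False False" "u = ?f z" by blast
      then obtain x v where v: "z = x # v" "length v = m" by (cases z) (auto simp: walks_def)
      then obtain w y where "v = w @ [y]" by (cases v rule: rev_cases) (auto simp: m)
      with z v show "\<exists>x w y. ?Q u x w y"
        by (intro exI[of _ x] exI[of _ w] exI[of _ y]) (auto simp: walks_def m)
    next
      assume "\<exists>x w y. ?Q u x w y"
      then obtain x w y where "?Q u x w y" by blast
      then show "u \<in> ?f ` walks (Suc m) False False"
        by (intro image_eqI[of _ _ "x # w @ [y]"]) (auto simp: butlast_append)
    qed
    also have "\<dots> \<longleftrightarrow> u \<in> reflection_fixed (2 * m) 0"
    proof
      assume u: "u \<in> reflection_fixed (2 * m) 0"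
      then have len: "length u = 2 * m" by (simp add: reflection_fixed_def lucas_strings_iff_cyc[OF n])
      then obtain x v where v: "u = x # v" by (cases u) (auto simp: m)
      then have "rev v = v" "length v = Suc (2 * k)"
        using u len v pal[of x v] by (simp_all add: reflection_fixed_def m)
      then obtain w y where w: "length w = k" "v = w @ y # rev w"
        by (auto elim: palindrome_odd)
      have "x # w @ y # rev w \<in> lucas_strings (2 * m)"
        using u v w by (simp add: reflection_fixed_def)
      then show "\<exists>x w y. ?Q u x w y" using v w * by blast
    next
      assume "\<exists>x w y. ?Q u x w y"
      then obtain x w y where "?Q u x w y" by blast
      then show "u \<in> reflection_fixed (2 * m) 0"
        using * pal[of x "w @ y # rev w"] by (simp add: reflection_fixed_def)
    qed
    finally show ?thesis by simp
  qed
  then have "reflection_fixed (2 * m) 0 = ?f ` walks (Suc m) False False" by blast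
  moreover have "inj_on ?f (walks (Suc m) False False)"
    by (rule inj_onI) (simp add: walks_def)
  ultimately show ?thesis by (simp add: card_image card_walks numeral_3_eq_3)
qed

lemma sum_card_reflection_fixed:
  assumes n: "n > 0"
  shows "(\<Sum>c<n. card (reflection_fixed n (int c))) = n * fib (n div 2 + 2)"
proof (cases "even n")
  case True
  then obtain m where m: "n = 2 * m" by blast
  with n have "m > 0" by simp
  have "card (reflection_fixed n (int (2 * k))) = fib (m + 3)" for k
    using card_reflection_fixed_shift[OF n, of 0 "int k"] card_reflection_fixed_even_zero[OF \<open>m > 0\<close>]
    by (simp add: m)
  moreover have "card (reflection_fixed n (int (Suc (2 * k)))) = fib m" for k
    \<comment> \<open>The odd number \<open>2 * k + 1\<close> is written as
      \<open>-1 + 2 * (k + 1)\<close>.\<close>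
    using card_reflection_fixed_shift[OF n, of "-1" "int k + 1"]
      card_reflection_fixed_even_minus_one[OF \<open>m > 0\<close>]
    by (simp add: m add.commute)
  moreover have "(\<Sum>c<2 * l. h c) = (\<Sum>k<l. h (2 * k) + h (Suc (2 * k)))" for h :: "nat \<Rightarrow> nat" and l
    by (induction l) simp_all
  ultimately have "(\<Sum>c<n. card (reflection_fixed n (int c))) = m * (fib (m + 3) + fib m)"
    by (simp add: m)
  \<comment> \<open>Both parities occur \<open>m\<close> times, and
    \<open>fib (m + 3) + fib m = 2 * fib (m + 2)\<close>.\<close>
  also have "\<dots> = n * fib (n div 2 + 2)" by (simp add: m numeral_3_eq_3)
  finally show ?thesis .
next
  case False
  then obtain m where m: "n = Suc (2 * m)" by (elim oddE) simp
  have "card (reflection_fixed n (int c)) = fib (m + 2)" for c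
  proof -
    have odd: "card (reflection_fixed n (int c)) = fib (m + 2)" if "odd c" for c
    proof -
      from that obtain k where "c = Suc (2 * k)" by (elim oddE) simp
      then show ?thesis
        using card_reflection_fixed_shift[OF n, of "-1" "int k + 1"] card_reflection_fixed_odd_minus_one[of m]
        by (simp add: m add.commute)
    qed
    show ?thesis
    proof (cases "odd c")
      case False
      \<comment> \<open>As \<open>n\<close> is odd, adding it changes the parity of \<open>c\<close>
        but not the reflection.\<close>
      then have "odd (c + n)" using m by simp
      note odd[OF this]
      moreover have "reflection_fixed n (int c) = reflection_fixed n (int (c + n))"
        by (rule reflection_fixed_cong[OF n]) (simp add: cong_def)
      ultimately show ?thesis by (simp only:)
    qed (rule odd)
  qed
  then show ?thesis by (simp add: m)
qed

text \<open>The terms with \<open>a = 2 * k\<close> and those with \<open>a = 2 * k + 1\<close> run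
  along two neighbouring shallow diagonals of Pascal's triangle, with sums
  \<open>fib (m + 1)\<close> and \<open>fib m\<close>.\<close>

lemma sum_choose_eq_fib:
  "(\<Sum>a = 0..m. (m - (a + 1) div 2) choose (a div 2)) = fib (m + 2)"
proof -
  have pairs: "(\<Sum>c<2 * l. h c) = (\<Sum>k<l. h (2 * k)) + (\<Sum>k<l. h (Suc (2 * k)))" for h :: "nat \<Rightarrow> nat" and l
    by (induction l) simp_all
  show ?thesis
  proof (cases m)
    case (Suc l)
    \<comment> \<open>Thus the range can be extended to full pairs by vanishing terms. For
      \<open>m = 0\<close> this fails at \<open>a = 1\<close>, where truncated subtraction gives
      \<open>0 choose 0 = 1\<close>; hence the case split.\<close>
    have "m - (a + 1) div 2 < a div 2" if "a > m" for a
      using that Suc by linarith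
    then have "(\<Sum>a = 0..m. (m - (a + 1) div 2) choose (a div 2)) =
        (\<Sum>a < 2 * Suc m. (m - (a + 1) div 2) choose (a div 2))"
      by (intro sum.mono_neutral_left) (auto simp: binomial_eq_0_iff)
    also have "\<dots> = (\<Sum>k<Suc m. (m - k) choose k) + (\<Sum>k<Suc m. (m - Suc k) choose k)"
      unfolding pairs by simp
    also have "(\<Sum>k<Suc m. (m - k) choose k) = fib (Suc m)"
      using ne_diagonal_fib[of m] by (simp only: lessThan_Suc_atMost atLeast0AtMost)
    also have "(\<Sum>k<Suc m. (m - Suc k) choose k) = (\<Sum>k<Suc l. (l - k) choose k)"
      by (simp add: Suc)
    also have "\<dots> = fib m"
      using ne_diagonal_fib[of l] by (simp only: lessThan_Suc_atMost atLeast0AtMost Suc)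
    finally show ?thesis by simp
  qed simp
qed

lemma sum_card_dihedral_fixed:
  assumes n: "n > 0"
  shows "(\<Sum>g\<in>dihedral n. card {u \<in> lucas_strings n. dih g u = u}) =
    (\<Sum>d | d dvd n. totient (n div d) * lucas d)
      + n * (\<Sum>a = 0..n div 2. (n div 2 - (a + 1) div 2) choose (a div 2))"
proof -
  let ?F = "\<lambda>g. card {u \<in> lucas_strings n. dih g u = u}"
  have nat: "(\<Sum>c\<in>{0..<int n}. h c) = (\<Sum>c<n. h (int c))" for h :: "int \<Rightarrow> nat"
    by (rule sum.reindex_bij_witness[of _ int nat]) auto
  have "(\<Sum>g\<in>dihedral n. ?F g) = (\<Sum>c\<in>{0..<int n}. ?F (1, c)) + (\<Sum>c\<in>{0..<int n}. ?F (-1, c))"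
    unfolding dihedral_def by (simp add: sum.cartesian_product')
  also have "\<dots> = (\<Sum>c<n. lucas (gcd c n)) + (\<Sum>c<n. card (reflection_fixed n (int c)))"
    unfolding nat by (simp only: card_rotation_fixed[OF n] dih_reflection_fixed[OF n])
  finally show ?thesis
    by (simp only: sum_gcd_eq_sum_totient[OF n] sum_card_reflection_fixed[OF n] sum_choose_eq_fib)
qed

section \<open>Automorphisms of the Lucas cube\<close>

lemma cong_affine_iff:
  fixes s :: int
  assumes "s \<in> {1, -1}"
  shows "[s * i + p = j] (mod m) \<longleftrightarrow> [i = s * (j - p)] (mod m)"
proof -
  have "i - s * (j - p) = s * (s * i + p - j)" using assms by (auto simp: algebra_simps)
  moreover have "m dvd s * x \<longleftrightarrow> m dvd x" for x using assms by auto
  ultimately show ?thesis by (simp only: cong_iff_dvd_diff)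
qed

text \<open>The differing places are described as one residue class on the cycle, so that a change
  of position can be substituted directly.\<close>

definition adj :: "nat \<Rightarrow> bool list \<Rightarrow> bool list \<Rightarrow> bool" where
  "adj n u v \<longleftrightarrow> (\<exists>j. \<forall>i. cyc u i \<noteq> cyc v i \<longleftrightarrow> [i = j] (mod int n))"

lemma adj_iff_card:
  assumes n: "n > 0" "length u = n" "length v = n"
  shows "adj n u v \<longleftrightarrow> card {i. i < n \<and> u ! i \<noteq> v ! i} = 1"
proof
  assume "adj n u v"
  then obtain j where j: "\<And>i. cyc u i \<noteq> cyc v i \<longleftrightarrow> [i = j] (mod int n)"
    by (auto simp: adj_def)
  define k where "k = nat (j mod int n)"
  have k: "k < n" "j mod int n = int k"
    using n(1) by (simp_all add: k_def nat_less_iff)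
  have "u ! i \<noteq> v ! i \<longleftrightarrow> i = k" if "i < n" for i
  proof -
    have "u ! i \<noteq> v ! i \<longleftrightarrow> [int i = j] (mod int n)"
      using j[of "int i"] that n by (simp add: nth_eq_cyc)
    then show ?thesis using that k by (simp add: cong_def)
  qed
  then have "{i. i < n \<and> u ! i \<noteq> v ! i} = {k}"
    using k(1) by auto
  then show "card {i. i < n \<and> u ! i \<noteq> v ! i} = 1" by simp
next
  assume "card {i. i < n \<and> u ! i \<noteq> v ! i} = 1"
  then obtain j where "{i. i < n \<and> u ! i \<noteq> v ! i} = {j}"
    by (auto simp: card_1_singleton_iff)
  then have j: "j < n" "i < n \<Longrightarrow> u ! i \<noteq> v ! i \<longleftrightarrow> i = j" for i by auto
  have "cyc u i \<noteq> cyc v i \<longleftrightarrow> [i = int j] (mod int n)" for i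
  proof -
    have "nat (i mod int n) < n" using n(1) by (simp add: nat_less_iff)
    then have "cyc u i \<noteq> cyc v i \<longleftrightarrow> nat (i mod int n) = j"
      using j(2) n by (simp add: cyc_def)
    also have "\<dots> \<longleftrightarrow> [i = int j] (mod int n)"
      using n(1) j(1) by (auto simp: cong_def nat_eq_iff)
    finally show ?thesis .
  qed
  then show "adj n u v" unfolding adj_def by blast
qed

lemma verts_lucas_cube: "verts (lucas_cube n) = lucas_strings n"
  by (auto simp: lucas_cube_def induced_subgraph_def hypercube_def lucas_strings_def)

lemma edges_lucas_cube:
  assumes n: "n > 0" and u: "u \<in> lucas_strings n" and v: "v \<in> lucas_strings n"
  shows "{u, v} \<in> edges (lucas_cube n) \<longleftrightarrow> adj n u v"
proof -
  have "{u, v} \<in> edges (lucas_cube n) \<longleftrightarrow> card {i. i < n \<and> u ! i \<noteq> v ! i} = 1"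
  proof
    assume "{u, v} \<in> edges (lucas_cube n)"
    then obtain x y where xy: "{u, v} = {x, y}" "card {i. i < n \<and> x ! i \<noteq> y ! i} = 1"
      by (auto simp: lucas_cube_def induced_subgraph_def hypercube_def)
    from xy(1) have "u = x \<and> v = y \<or> u = y \<and> v = x" by (simp add: doubleton_eq_iff)
    moreover have "{i. i < n \<and> y ! i \<noteq> x ! i} = {i. i < n \<and> x ! i \<noteq> y ! i}"
      by (rule Collect_cong) (simp only: eq_commute)
    ultimately show "card {i. i < n \<and> u ! i \<noteq> v ! i} = 1"
      using xy(2) by (elim disjE conjE) (simp_all only:)
  next
    assume "card {i. i < n \<and> u ! i \<noteq> v ! i} = 1"
    then show "{u, v} \<in> edges (lucas_cube n)"
      using u v by (auto simp: lucas_cube_def induced_subgraph_def hypercube_def lucas_strings_def)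
  qed
  then show ?thesis
    using adj_iff_card n u v by (simp add: lucas_strings_iff_cyc)
qed

text \<open>Signs are their own inverses, so the inverse keeps \<open>s\<close> and has shift
  \<open>- s * p\<close>. The shift is given up to congruence to allow both this value and its
  reduced form in \<open>dihedral n\<close>.\<close>

lemma dih_inverse:
  assumes "u \<noteq> []" "s \<in> {1, -1}" "[q = - s * p] (mod int (length u))"
  shows "dih (s, q) (dih (s, p) u) = u"
proof (rule cyc_eqI)
  have ne: "dih (s, p) u \<noteq> []" using assms(1) length_dih[of "(s, p)" u] by force
  have "[s * (s * i + q) + p = s * (s * i + (- s * p)) + p] (mod int (length u))" for i
    using assms(3) by (intro cong_add cong_scalar_left cong_refl)
  moreover have "s * (s * i + (- s * p)) + p = i" for i
    using assms(2) by (auto simp: algebra_simps)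
  ultimately have "[s * (s * i + q) + p = i] (mod int (length u))" for i by simp
  then show "cyc (dih (s, q) (dih (s, p) u)) i = cyc u i" for i
    by (simp add: cyc_dih[OF ne] cyc_dih[OF assms(1)] cyc_cong)
qed simp

lemma adj_dih:
  assumes "u \<noteq> []" "v \<noteq> []" "s \<in> {1, -1}" "adj n u v"
  shows "adj n (dih (s, p) u) (dih (s, p) v)"
proof -
  obtain j where "\<And>i. cyc u i \<noteq> cyc v i \<longleftrightarrow> [i = j] (mod int n)"
    using assms(4) by (auto simp: adj_def)
  then have "cyc (dih (s, p) u) i \<noteq> cyc (dih (s, p) v) i \<longleftrightarrow> [i = s * (j - p)] (mod int n)" for i
    using assms(3) by (simp add: cyc_dih assms(1,2) cong_affine_iff)
  then show ?thesis unfolding adj_def by blast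
qed

section \<open>Flips, the zero string and the unit strings\<close>

definition flip :: "int \<Rightarrow> bool list \<Rightarrow> bool list" where
  "flip j u = of_cyc (length u) (\<lambda>i. cyc u i \<noteq> [i = j] (mod int (length u)))"

lemma length_flip [simp]: "length (flip j u) = length u"
  by (simp add: flip_def)

lemma cyc_flip: "u \<noteq> [] \<Longrightarrow> cyc (flip j u) i \<longleftrightarrow> cyc u i \<noteq> [i = j] (mod int (length u))"
  unfolding flip_def by (rule cyc_of_cyc) (simp_all add: cong_def)

lemma adj_iff_flip:
  assumes "length u = n" "length v = n" "n > 0"
  shows "adj n u v \<longleftrightarrow> (\<exists>j. v = flip j u)"
proof -
  have ne: "u \<noteq> []" using assms by auto
  have "v = flip j u \<longleftrightarrow> (\<forall>i. cyc v i \<longleftrightarrow> cyc u i \<noteq> [i = j] (mod int n))" for j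
    using assms cyc_flip[OF ne] by (auto intro: cyc_eqI)
  then show ?thesis by (auto simp: adj_def)
qed

lemma flip_off_in_lucas_strings:
  assumes "u \<in> lucas_strings n" "cyc u j" "n > 0"
  shows "flip j u \<in> lucas_strings n"
proof -
  have u: "length u = n" "u \<noteq> []" "\<And>i. \<not> (cyc u i \<and> cyc u (i + 1))"
    using assms by (auto simp: lucas_strings_iff_cyc)
  have "cyc (flip j u) i \<Longrightarrow> cyc u i" for i
    using cyc_cong[of i j u] assms(2) by (auto simp: cyc_flip[OF u(2)])
  then show ?thesis using u assms(3) by (auto simp: lucas_strings_iff_cyc)
qed

definition zeros :: "nat \<Rightarrow> bool list" where
  "zeros n = replicate n False"

definition unit_string :: "nat \<Rightarrow> int \<Rightarrow> bool list" where
  "unit_string n j = flip j (zeros n)"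

lemma length_zeros [simp]: "length (zeros n) = n"
  by (simp add: zeros_def)

lemma zeros_not_Nil: "n > 0 \<Longrightarrow> zeros n \<noteq> []"
  by (simp add: zeros_def)

lemma cyc_zeros: "n > 0 \<Longrightarrow> \<not> cyc (zeros n) i"
  by (simp add: cyc_def zeros_def nat_less_iff)

lemma zeros_in_lucas_strings: "n > 0 \<Longrightarrow> zeros n \<in> lucas_strings n"
  by (simp add: lucas_strings_iff_cyc cyc_zeros)

lemma length_unit_string [simp]: "length (unit_string n j) = n"
  by (simp add: unit_string_def)

lemma cyc_unit_string: "n > 0 \<Longrightarrow> cyc (unit_string n j) i \<longleftrightarrow> [i = j] (mod int n)"
  by (simp add: unit_string_def cyc_flip cyc_zeros zeros_not_Nil)

lemma unit_string_eq_iff: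
  "n > 0 \<Longrightarrow> unit_string n i = unit_string n j \<longleftrightarrow> [i = j] (mod int n)"
proof
  assume "n > 0" "unit_string n i = unit_string n j"
  then show "[i = j] (mod int n)"
    using cyc_unit_string[of n i i] cyc_unit_string[of n j i] by simp
next
  assume "n > 0" "[i = j] (mod int n)"
  then show "unit_string n i = unit_string n j"
    by (intro cyc_eqI) (auto simp: cyc_unit_string cong_def)
qed

lemma not_cong_Suc: "n \<ge> 2 \<Longrightarrow> \<not> [i + 1 = i] (mod int n)"
  by (simp add: cong_iff_dvd_diff)

lemma unit_string_in_lucas_strings:
  assumes "n \<ge> 2"
  shows "unit_string n j \<in> lucas_strings n"
proof -
  have "\<not> ([i = j] (mod int n) \<and> [i + 1 = j] (mod int n))" for i
    using not_cong_Suc[OF assms, of i] by (simp add: cong_def)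
  then show ?thesis using assms by (simp add: lucas_strings_iff_cyc cyc_unit_string)
qed

lemma two_units_in_lucas_strings:
  assumes n: "n \<ge> 2"
    and "\<not> [j = i + 1] (mod int n)" "\<not> [j = i - 1] (mod int n)"
  shows "flip j (unit_string n i) \<in> lucas_strings n"
proof -
  have ne: "unit_string n i \<noteq> []" using n length_unit_string[of n i] by force
  have False if l: "cyc (flip j (unit_string n i)) l" "cyc (flip j (unit_string n i)) (l + 1)" for l
  proof -
    have "[l = i] (mod int n) \<or> [l = j] (mod int n)" "[l + 1 = i] (mod int n) \<or> [l + 1 = j] (mod int n)"
      using l n by (auto simp: cyc_flip[OF ne] cyc_unit_string)
    moreover have "\<not> ([l = x] (mod int n) \<and> [l + 1 = x] (mod int n))" for x
      using not_cong_Suc[OF n, of l] by (simp add: cong_def)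
    moreover have "[j = i + 1] (mod int n)" if "[l = i] (mod int n)" "[l + 1 = j] (mod int n)"
      using cong_trans[OF cong_sym[OF that(2)] cong_add[OF that(1) cong_refl[of 1]]] .
    moreover have "[j = i - 1] (mod int n)" if "[l = j] (mod int n)" "[l + 1 = i] (mod int n)"
      using cong_trans[OF cong_sym[OF that(1)] cong_diff[OF that(2) cong_refl[of 1], simplified]] .
    ultimately show False using assms(2,3) by blast
  qed
  then show ?thesis using n by (auto simp: lucas_strings_iff_cyc)
qed

text \<open>The images of the \<open>n\<close> unit strings are \<open>n\<close> distinct neighbours
  of \<open>f (zeros n)\<close>. A vertex with a 1 at \<open>p\<close> has at most
  \<open>n - 1\<close> neighbours, since the place \<open>p + 1\<close> cannot be flipped.\<close>

lemma lucas_cube_hom_zeros: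
  assumes n: "n \<ge> 2"
    and inj: "inj_on f (lucas_strings n)"
    and maps: "f ` lucas_strings n \<subseteq> lucas_strings n"
    and hom: "\<And>u v. u \<in> lucas_strings n \<Longrightarrow> v \<in> lucas_strings n \<Longrightarrow> adj n u v \<Longrightarrow> adj n (f u) (f v)"
  shows "f (zeros n) = zeros n"
proof (rule ccontr)
  assume neq: "f (zeros n) \<noteq> zeros n"
  define u where "u = f (zeros n)"
  have n0: "n > 0" using n by simp
  have z: "zeros n \<in> lucas_strings n" by (rule zeros_in_lucas_strings[OF n0])
  then have uL: "u \<in> lucas_strings n" using maps by (auto simp: u_def)
  then have u: "length u = n" "u \<noteq> []" using n0 by (auto simp: lucas_strings_iff_cyc)
  have "\<exists>p. cyc u p"
  proof (rule ccontr)
    assume "\<not> (\<exists>p. cyc u p)"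
    then have "u = zeros n" using u n0 by (intro cyc_eqI) (simp_all add: cyc_zeros)
    then show False using neq by (simp add: u_def)
  qed
  then obtain p where p: "cyc u p" ..
  let ?J = "{0..<int n}"
  let ?q = "(p + 1) mod int n"
  have nbrs: "f (unit_string n j) \<in> (\<lambda>j. flip j u) ` (?J - {?q})" for j
  proof -
    let ?v = "f (unit_string n j)"
    have e: "unit_string n j \<in> lucas_strings n" by (rule unit_string_in_lucas_strings[OF n])
    then have vL: "?v \<in> lucas_strings n" using maps by blast
    then have v: "length ?v = n" "\<And>i. \<not> (cyc ?v i \<and> cyc ?v (i + 1))"
      using n0 by (auto simp: lucas_strings_iff_cyc)
    have "adj n (zeros n) (unit_string n j)"
      unfolding adj_iff_flip[OF length_zeros length_unit_string n0] by (auto simp: unit_string_def)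
    then have "adj n u ?v" unfolding u_def by (intro hom z e)
    then obtain k where k: "?v = flip k u"
      using adj_iff_flip[OF u(1) v(1) n0] by blast
    also have k': "flip k u = flip (k mod int n) u"
      by (rule cyc_eqI) (simp_all add: cyc_flip u cong_def)
    finally have "?v = flip (k mod int n) u" .
    moreover have "k mod int n \<noteq> ?q"
    proof
      assume "k mod int n = ?q"
      then have kp: "[k = p + 1] (mod int n)" by (simp add: cong_def)
      have "\<not> [p = k] (mod int n)"
        using not_cong_Suc[OF n, of p] kp by (simp add: cong_def)
      moreover have "\<not> cyc u (p + 1)" using uL p n0 by (auto simp: lucas_strings_iff_cyc)
      ultimately have "cyc ?v p \<and> cyc ?v (p + 1)"
        using p kp by (simp add: k cyc_flip u cong_sym_eq)
      then show False using v(2) by blast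
    qed
    ultimately show ?thesis using n0 by auto
  qed
  have "int n = int (card (f ` unit_string n ` ?J))"
  proof -
    have "inj_on (unit_string n) ?J"
      using n0 by (auto intro!: inj_onI simp: unit_string_eq_iff cong_def)
    moreover have "inj_on f (unit_string n ` ?J)"
      by (rule inj_on_subset[OF inj]) (use unit_string_in_lucas_strings[OF n] in blast)
    ultimately show ?thesis by (simp add: card_image)
  qed
  also have "\<dots> \<le> int (card ((\<lambda>j. flip j u) ` (?J - {?q})))"
    using nbrs by (auto intro!: card_mono)
  also have "\<dots> \<le> int (card (?J - {?q}))"
    by (simp add: card_image_le)
  also have "\<dots> = int n - 1" using n0 by simp
  finally show False by simp
qed

text \<open>Preservation of edges places \<open>f u\<close> among the common neighbours of two fixed
  vertices, and injectivity excludes the wrong one. The zero string and the unit strings are the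
  base cases.\<close>

lemma lucas_cube_hom_eq_id:
  assumes n: "n \<ge> 2"
    and inj: "inj_on f (lucas_strings n)"
    and maps: "f ` lucas_strings n \<subseteq> lucas_strings n"
    and hom: "\<And>u v. u \<in> lucas_strings n \<Longrightarrow> v \<in> lucas_strings n \<Longrightarrow> adj n u v \<Longrightarrow> adj n (f u) (f v)"
    and units: "\<And>i. f (unit_string n i) = unit_string n i"
  shows "u \<in> lucas_strings n \<Longrightarrow> f u = u"
proof (induction "card {i \<in> {0..<int n}. cyc u i}" arbitrary: u rule: less_induct)
  case less
  have n0: "n > 0" using n by simp
  have u: "length u = n" "u \<noteq> []" using less.prems n0 by (auto simp: lucas_strings_iff_cyc)
  show ?case
  proof (cases "\<exists>a b. cyc u a \<and> cyc u b \<and> \<not> [a = b] (mod int n)")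
    case False
    show ?thesis
    proof (cases "\<exists>a. cyc u a")
      case True
      then obtain a where a: "cyc u a" ..
      have "cyc u i \<longleftrightarrow> [i = a] (mod int n)" for i
        using False a cyc_cong[of i a u] u(1) by blast
      then have "u = unit_string n a"
        using u n0 by (intro cyc_eqI) (simp_all add: cyc_unit_string)
      then show ?thesis using units by simp
    next
      case False
      then have "u = zeros n" using u n0 by (intro cyc_eqI) (simp_all add: cyc_zeros)
      then show ?thesis using lucas_cube_hom_zeros[OF n inj maps hom] by simp
    qed
  next
    case True
    then obtain a b where ab: "cyc u a" "cyc u b" "\<not> [a = b] (mod int n)" by blast
    have smaller: "f v = v" if "v \<in> lucas_strings n" "\<And>i. cyc v i \<Longrightarrow> cyc u i" "cyc u c" "\<not> cyc v c" for v c
    proof (rule less.hyps)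
      have "length v = n" using that(1) n0 by (simp add: lucas_strings_iff_cyc)
      then have "c mod int n \<in> {i \<in> {0..<int n}. cyc u i} - {i \<in> {0..<int n}. cyc v i}"
        using that n0 u by simp
      then have "{i \<in> {0..<int n}. cyc v i} \<subset> {i \<in> {0..<int n}. cyc u i}"
        using that(2) by blast
      then show "card {i \<in> {0..<int n}. cyc v i} < card {i \<in> {0..<int n}. cyc u i}"
        by (rule psubset_card_mono[rotated])
          (rule finite_subset[of _ "{0..<int n}"], auto)
    qed (rule that)
    define ua ub uab where "ua = flip a u" and "ub = flip b u" and "uab = flip b (flip a u)"
    have ne: "flip a u \<noteq> []" using u length_flip[of a u] by force
    have cyc_u: "cyc ua i \<longleftrightarrow> cyc u i \<noteq> [i = a] (mod int n)" "cyc ub i \<longleftrightarrow> cyc u i \<noteq> [i = b] (mod int n)"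
      "cyc uab i \<longleftrightarrow> (cyc u i \<noteq> [i = a] (mod int n)) \<noteq> [i = b] (mod int n)" for i
      using u ne by (simp_all add: ua_def ub_def uab_def cyc_flip)
    have off: "[i = a] (mod int n) \<Longrightarrow> cyc u i" "[i = b] (mod int n) \<Longrightarrow> cyc u i" for i
      using ab cyc_cong[of i _ u] u(1) by blast+
    have ba: "\<not> [b = a] (mod int n)" using ab(3) cong_sym by blast
    have L: "ua \<in> lucas_strings n" "ub \<in> lucas_strings n"
      using less.prems ab n0 by (simp_all add: ua_def ub_def flip_off_in_lucas_strings)
    moreover have "cyc ua b" using ab ba by (simp add: cyc_u)
    ultimately have Lab: "uab \<in> lucas_strings n"
      using n0 by (simp add: uab_def flip_off_in_lucas_strings flip: ua_def)
    have fixd: "f ua = ua" "f ub = ub" "f uab = uab"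
      using smaller[OF L(1), of a] smaller[OF L(2), of b] smaller[OF Lab, of a] ab off
      by (auto simp: cyc_u)
    have "adj n ua u" "adj n ub u" unfolding adj_def cyc_u by blast+
    then have "adj n ua (f u)" "adj n ub (f u)"
      using hom L less.prems fixd by metis+
    then obtain j k where
      j: "\<And>i. cyc ua i \<noteq> cyc (f u) i \<longleftrightarrow> [i = j] (mod int n)" and
      k: "\<And>i. cyc ub i \<noteq> cyc (f u) i \<longleftrightarrow> [i = k] (mod int n)"
      unfolding adj_def by blast
    have "f u \<in> lucas_strings n" using maps less.prems by blast
    then have fu: "length (f u) = n" by (simp add: lucas_strings_iff_cyc[OF n0])
    show ?thesis
    proof (cases "[a = j] (mod int n)")
      case True
      then have "[i = j] (mod int n) \<longleftrightarrow> [i = a] (mod int n)" for i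
        by (auto simp: cong_def)
      then have "cyc (f u) i = cyc u i" for i
        using j[of i] by (auto simp: cyc_u)
      then show ?thesis using u fu by (intro cyc_eqI) simp_all
    next
      \<comment> \<open>Here \<open>f u\<close> agrees with \<open>ua\<close> at \<open>a\<close>.
        Comparing with \<open>ub\<close> at \<open>a\<close>, then with both at \<open>b\<close>,
        gives \<open>k = a\<close> and \<open>j = b\<close> modulo \<open>n\<close>, so
        \<open>f u\<close> is the other common neighbour \<open>uab\<close>, which is itself
        fixed.\<close>
      case False
      then have ak: "[a = k] (mod int n)"
        using j[of a] k[of a] ab(3) by (auto simp: cyc_u)
      then have "\<not> [b = k] (mod int n)" using ba by (simp add: cong_def)
      then have bj: "[b = j] (mod int n)"
        using j[of b] k[of b] ba by (auto simp: cyc_u)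
      then have "[i = j] (mod int n) \<longleftrightarrow> [i = b] (mod int n)" for i
        by (auto simp: cong_def)
      then have "cyc (f u) i = cyc uab i" for i
        using j[of i] by (auto simp: cyc_u)
      then have "f u = uab" using u fu by (intro cyc_eqI) (simp_all add: uab_def)
      then have "u = uab"
        using inj less.prems Lab fixd(3) by (metis inj_onD)
      then show ?thesis using cyc_u(3)[of a] ab by auto
    qed
  qed
qed

text \<open>The induced permutation of residues takes neighbours on the cycle to neighbours. Its
  first step fixes a direction \<open>s\<close>, and by injectivity it cannot turn back
  later.\<close>

lemma lucas_cube_auto_unit_strings:
  assumes n: "n \<ge> 2"
    and bij: "bij_betw f (lucas_strings n) (lucas_strings n)"
    and adj: "\<And>u v. u \<in> lucas_strings n \<Longrightarrow> v \<in> lucas_strings n \<Longrightarrow> adj n (f u) (f v) \<longleftrightarrow> adj n u v"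
  obtains s p where "s \<in> {1, -1}" "\<And>i. f (unit_string n i) = unit_string n (s * i + p)"
proof -
  have n0: "n > 0" using n by simp
  have inj: "inj_on f (lucas_strings n)" and img: "f ` lucas_strings n = lucas_strings n"
    using bij by (simp_all add: bij_betw_def)
  have z: "zeros n \<in> lucas_strings n" by (rule zeros_in_lucas_strings[OF n0])
  have e: "unit_string n i \<in> lucas_strings n" for i by (rule unit_string_in_lucas_strings[OF n])
  have fz: "f (zeros n) = zeros n"
    by (rule lucas_cube_hom_zeros[OF n inj]) (simp_all add: img adj)
  have adj_ze: "adj n (zeros n) (unit_string n i)" for i
    unfolding adj_iff_flip[OF length_zeros length_unit_string n0] by (auto simp: unit_string_def)
  have "\<exists>j. f (unit_string n i) = unit_string n j" for i
  proof -
    have "f (unit_string n i) \<in> lucas_strings n" using e img by blast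
    then have "length (f (unit_string n i)) = n" by (simp add: lucas_strings_iff_cyc[OF n0])
    moreover have "adj n (zeros n) (f (unit_string n i))"
      using adj[OF z e] adj_ze fz by simp
    ultimately show ?thesis
      using adj_iff_flip[OF length_zeros _ n0] by (simp add: unit_string_def)
  qed
  \<comment> \<open>The value \<open>\<pi> i\<close> is an arbitrary representative of its class, so
    everything about \<open>\<pi>\<close> is stated modulo \<open>n\<close>.\<close>
  then obtain \<pi> where \<pi>: "\<And>i. f (unit_string n i) = unit_string n (\<pi> i)" by metis
  have \<pi>_cong: "[\<pi> i = \<pi> j] (mod int n) \<longleftrightarrow> [i = j] (mod int n)" for i j
    using inj_on_eq_iff[OF inj e e, of i j] by (simp add: \<pi> unit_string_eq_iff[OF n0])
  have step: "[\<pi> (i + 1) = \<pi> i + 1] (mod int n) \<or> [\<pi> (i + 1) = \<pi> i - 1] (mod int n)" for i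
  proof (rule ccontr)
    \<comment> \<open>Otherwise two \<open>1\<close>s fit in the places \<open>\<pi> i\<close> and \<open>\<pi> (i + 1)\<close>, which gives a second common
      neighbour of the two unit strings; but those at \<open>i\<close> and \<open>i + 1\<close> have only one.\<close>
    assume far: "\<not> ?thesis"
    define w where "w = flip (\<pi> (i + 1)) (unit_string n (\<pi> i))"
    have w: "w \<in> lucas_strings n"
      unfolding w_def using two_units_in_lucas_strings[OF n] far by blast
    have ne: "unit_string n j \<noteq> []" for j using n0 length_unit_string[of n j] by force
    have cyc_w: "cyc w l \<longleftrightarrow> [l = \<pi> i] (mod int n) \<noteq> [l = \<pi> (i + 1)] (mod int n)" for l
      by (simp add: w_def cyc_flip[OF ne] cyc_unit_string[OF n0])
    from w have "w \<in> f ` lucas_strings n" by (simp only: img)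
    then obtain v where v: "v \<in> lucas_strings n" "f v = w" by blast
    have "adj n (unit_string n (\<pi> i)) w" "adj n (unit_string n (\<pi> (i + 1))) w"
      unfolding adj_def cyc_w cyc_unit_string[OF n0] by blast+
    then have "adj n (unit_string n i) v" "adj n (unit_string n (i + 1)) v"
      using adj[OF e v(1)] v(2) by (simp_all add: \<pi>)
    then obtain j k where
      j: "\<And>l. [l = i] (mod int n) \<noteq> cyc v l \<longleftrightarrow> [l = j] (mod int n)" and
      k: "\<And>l. [l = i + 1] (mod int n) \<noteq> cyc v l \<longleftrightarrow> [l = k] (mod int n)"
      unfolding adj_def cyc_unit_string[OF n0] by blast
    have ne1: "\<not> [i + 1 = i] (mod int n)" "\<not> [i = i + 1] (mod int n)"
      using not_cong_Suc[OF n, of i] by (auto simp: cong_def)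
    \<comment> \<open>A common neighbour of the unit strings at \<open>i\<close> and
      \<open>i + 1\<close> has either no 1 or both; the latter is not a Lucas string.\<close>
    have "\<not> (cyc v i \<and> cyc v (i + 1))" using v(1) by (simp add: lucas_strings_iff_cyc[OF n0])
    then have "[i = j] (mod int n)"
      using j[of i] j[of "i + 1"] k[of i] k[of "i + 1"] ne1 by (auto simp: cong_def)
    then have "\<not> cyc v l" for l
      using j[of l] by (auto simp: cong_def)
    then have "v = zeros n"
      using v(1) by (intro cyc_eqI) (simp_all add: cyc_zeros[OF n0] lucas_strings_iff_cyc[OF n0])
    then have "w = zeros n" using v(2) fz by simp
    then have "[\<pi> i = \<pi> (i + 1)] (mod int n)"
      using cyc_w[of "\<pi> i"] cyc_zeros[OF n0] by simp
    then show False using \<pi>_cong ne1 by blast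
  qed
  obtain s where s: "s \<in> {1, -1}" "[\<pi> 1 = \<pi> 0 + s] (mod int n)"
    using step[of 0] by (auto simp del: add_uminus_conv_diff simp add: diff_conv_add_uminus)
  \<comment> \<open>Two consecutive places are carried along, since excluding a turn back refers to
    the previous value.\<close>
  have "[\<pi> (int k) = s * int k + \<pi> 0] (mod int n) \<and>
      [\<pi> (int (Suc k)) = s * int (Suc k) + \<pi> 0] (mod int n)" for k
  proof (induction k)
    case 0
    then show ?case using s(2) by (simp add: add.commute)
  next
    case (Suc k)
    let ?j = "int (Suc k)"
    consider "[\<pi> (?j + 1) = \<pi> ?j + s] (mod int n)" | "[\<pi> (?j + 1) = \<pi> ?j - s] (mod int n)"
      using step[of ?j] s(1) by auto
    then have "[\<pi> (?j + 1) = \<pi> ?j + s] (mod int n)"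
    proof cases
      case 2
      have "[\<pi> ?j - s = s * ?j + \<pi> 0 - s] (mod int n)"
        using Suc by (intro cong_diff cong_refl) blast
      also have "s * ?j + \<pi> 0 - s = s * int k + \<pi> 0" by (simp add: algebra_simps)
      also have "[s * int k + \<pi> 0 = \<pi> (int k)] (mod int n)" using Suc cong_sym by blast
      finally have "[\<pi> (?j + 1) = \<pi> (int k)] (mod int n)" using 2 cong_trans by blast
      then have "[?j + 1 = int k] (mod int n)" by (simp only: \<pi>_cong)
      \<comment> \<open>Turning back is possible only for \<open>n = 2\<close>, where the steps
        \<open>s\<close> and \<open>-s\<close> agree modulo \<open>n\<close>.\<close>
      then have "int n dvd 2" by (simp add: cong_iff_dvd_diff)
      then have "[\<pi> ?j - s = \<pi> ?j + s] (mod int n)"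
        using s(1) by (auto simp: cong_iff_dvd_diff)
      with 2 show ?thesis by (rule cong_trans)
    qed
    also have "[\<pi> ?j + s = s * ?j + \<pi> 0 + s] (mod int n)"
      using Suc by (intro cong_add cong_refl) blast
    also have "s * ?j + \<pi> 0 + s = s * int (Suc (Suc k)) + \<pi> 0" by (simp add: algebra_simps)
    finally show ?case using Suc by (simp add: add.commute)
  qed
  then have nat: "[\<pi> (int k) = s * int k + \<pi> 0] (mod int n)" for k by blast
  have "f (unit_string n i) = unit_string n (s * i + \<pi> 0)" for i
  proof -
    define k where "k = nat (i mod int n)"
    have k: "[i = int k] (mod int n)" using n0 by (simp add: k_def cong_def)
    then have "[\<pi> i = s * int k + \<pi> 0] (mod int n)"
      using nat[of k] \<pi>_cong cong_trans by blast
    also have "[s * int k + \<pi> 0 = s * i + \<pi> 0] (mod int n)"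
      by (intro cong_add cong_scalar_left cong_refl cong_sym[OF k])
    finally show ?thesis by (simp add: \<pi> unit_string_eq_iff[OF n0])
  qed
  with s(1) show ?thesis by (rule that)
qed

lemma lucas_cube_auto_is_dih:
  assumes n: "n > 0"
    and bij: "bij_betw f (lucas_strings n) (lucas_strings n)"
    and adj: "\<And>u v. u \<in> lucas_strings n \<Longrightarrow> v \<in> lucas_strings n \<Longrightarrow> adj n (f u) (f v) \<longleftrightarrow> adj n u v"
  obtains g where "g \<in> dihedral n" "\<And>u. u \<in> lucas_strings n \<Longrightarrow> f u = dih g u"
proof (cases "n = 1")
  case True
  \<comment> \<open>For \<open>n = 1\<close> the zero string is the only vertex, so the argument by
    unit strings does not apply.\<close>
  have "u = zeros 1" if "u \<in> lucas_strings 1" for u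
    using that by (auto simp: lucas_strings_def binary_strings_def zeros_def length_Suc_conv)
  moreover have "zeros 1 \<in> lucas_strings 1" by (rule zeros_in_lucas_strings) simp
  ultimately have "f u = dih (1, 0) u" if "u \<in> lucas_strings n" for u
    using that bij True by (metis bij_betwE dih_one zeros_not_Nil n)
  then show ?thesis using that[of "(1, 0)"] True by (simp add: dihedral_def)
next
  case False
  with n have n2: "n \<ge> 2" by simp
  obtain s p where s: "s \<in> {1, -1}" and fe: "\<And>i. f (unit_string n i) = unit_string n (s * i + p)"
    using lucas_cube_auto_unit_strings[OF n2 bij adj] by blast
  have ne: "u \<noteq> []" "length u = n" if "u \<in> lucas_strings n" for u
    using that n by (auto simp: lucas_strings_iff_cyc)
  have inj: "inj_on f (lucas_strings n)" and img: "f ` lucas_strings n = lucas_strings n"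
    using bij by (simp_all add: bij_betw_def)
  have fL: "f u \<in> lucas_strings n" if "u \<in> lucas_strings n" for u
    using bij that by (rule bij_betw_apply)
  define q where "q = (- s * p) mod int n"
  have q: "[q = - s * p] (mod int n)" by (simp add: q_def cong_def)
  \<comment> \<open>Since \<open>dih (s, p)\<close> reads position \<open>s * i + p\<close> at
    \<open>i\<close>, it takes the image of each unit string back to that unit string.\<close>
  let ?h = "\<lambda>u. dih (s, p) (f u)"
  have inv: "dih (s, q) (dih (s, p) u) = u" if "u \<in> lucas_strings n" for u
    by (rule dih_inverse[OF _ s]) (use q ne[OF that] in simp_all)
  have id: "?h u = u" if "u \<in> lucas_strings n" for u
  proof (rule lucas_cube_hom_eq_id[OF n2 _ _ _ _ that])
    show "inj_on ?h (lucas_strings n)"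
    proof (rule inj_onI)
      fix u v assume uv: "u \<in> lucas_strings n" "v \<in> lucas_strings n" "?h u = ?h v"
      from uv(3) have "dih (s, q) (?h u) = dih (s, q) (?h v)" by (simp only:)
      then have "f u = f v" by (simp only: inv[OF fL[OF uv(1)]] inv[OF fL[OF uv(2)]])
      then show "u = v" using inj uv(1,2) by (simp add: inj_on_eq_iff)
    qed
    show "?h ` lucas_strings n \<subseteq> lucas_strings n"
      using fL dih_in_lucas_strings[OF n, of "(s, p)"] s by (intro image_subsetI) simp
    show "adj n (?h u) (?h v)" if "u \<in> lucas_strings n" "v \<in> lucas_strings n" "adj n u v" for u v
      using that adj by (intro adj_dih[OF ne(1) ne(1) s] fL) simp_all
    show "?h (unit_string n i) = unit_string n i" for i
    proof (rule cyc_eqI)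
      fix l
      have ne': "unit_string n (s * i + p) \<noteq> []"
        by (rule ne(1)[OF unit_string_in_lucas_strings[OF n2]])
      have "cyc (?h (unit_string n i)) l \<longleftrightarrow> [s * l + p = s * i + p] (mod int n)"
        by (simp only: fe cyc_dih[OF ne'] fst_conv snd_conv cyc_unit_string[OF n])
      also have "\<dots> \<longleftrightarrow> [l = s * (s * i + p - p)] (mod int n)"
        by (rule cong_affine_iff[OF s])
      also have "s * (s * i + p - p) = i" using s by auto
      finally show "cyc (?h (unit_string n i)) l = cyc (unit_string n i) l"
        by (simp only: cyc_unit_string[OF n])
    qed (simp add: fe)
  qed
  have "f u = dih (s, q) u" if "u \<in> lucas_strings n" for u
    using inv[OF fL[OF that]] id[OF that] by simp
  moreover have "(s, q) \<in> dihedral n"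
    using s n by (auto simp: dihedral_def q_def)
  ultimately show ?thesis by (rule that[rotated])
qed

text \<open>Orbits rather than groups are compared, because distinct pairs in
  \<open>dihedral n\<close> induce the same map for \<open>n \<le> 2\<close>.\<close>

lemma orbit_lucas_cube:
  assumes n: "n > 0" and u: "u \<in> lucas_strings n"
  shows "orbit (Aut (lucas_cube n)) (\<lambda>f. f) u = (\<lambda>g. dih g u) ` dihedral n"
proof -
  have auto_iff: "f \<in> automorphisms (lucas_cube n) \<longleftrightarrow>
      f \<in> extensional (lucas_strings n) \<and> bij_betw f (lucas_strings n) (lucas_strings n) \<and>
      (\<forall>u\<in>lucas_strings n. \<forall>v\<in>lucas_strings n. adj n (f u) (f v) \<longleftrightarrow> adj n u v)" for f
  proof -
    have "{f u, f v} \<in> edges (lucas_cube n) \<longleftrightarrow> adj n (f u) (f v)"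
      if "bij_betw f (lucas_strings n) (lucas_strings n)" "u \<in> lucas_strings n" "v \<in> lucas_strings n" for u v
      using that edges_lucas_cube[OF n] by (blast dest: bij_betwE)
    then show ?thesis
      using edges_lucas_cube[OF n]
      by (auto simp: automorphisms_def Bij_def verts_lucas_cube)
  qed
  \<comment> \<open>Elements of \<open>BijGroup\<close> are extensional, so \<open>dih g\<close> has
    to be restricted to the vertex set.\<close>
  have dih_auto: "restrict (dih g) (lucas_strings n) \<in> automorphisms (lucas_cube n)" if g: "g \<in> dihedral n" for g
  proof -
    obtain s p where sp: "g = (s, p)" "s \<in> {1, -1}" using g by (auto simp: dihedral_def)
    have ne: "u \<noteq> []" "length u = n" if "u \<in> lucas_strings n" for u
      using that n by (auto simp: lucas_strings_iff_cyc)
    have L: "dih (s, q) u \<in> lucas_strings n" if "u \<in> lucas_strings n" for u q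
      using dih_in_lucas_strings[OF n _ that] sp(2) by simp
    have inv: "dih (s, - s * p) (dih (s, p) u) = u" if "u \<in> lucas_strings n" for u
      by (rule dih_inverse[OF _ sp(2)]) (use ne[OF that] in simp_all)
    have "inj_on (dih (s, p)) (lucas_strings n)"
      by (rule inj_on_inverseI) (rule inv)
    moreover have "dih (s, p) ` lucas_strings n \<subseteq> lucas_strings n"
      using L by (rule image_subsetI)
    ultimately have "bij_betw (dih (s, p)) (lucas_strings n) (lucas_strings n)"
      by (simp add: bij_betw_def endo_inj_surj)
    moreover have "adj n (dih (s, p) u) (dih (s, p) v) \<longleftrightarrow> adj n u v"
      if "u \<in> lucas_strings n" "v \<in> lucas_strings n" for u v
      using that adj_dih[OF ne(1) ne(1) sp(2)] L inv by metis
    ultimately show ?thesis by (simp add: auto_iff sp(1) cong: bij_betw_cong)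
  qed
  show ?thesis
  proof (intro equalityI subsetI)
    fix v assume "v \<in> orbit (Aut (lucas_cube n)) (\<lambda>f. f) u"
    then obtain f where f: "f \<in> automorphisms (lucas_cube n)" "v = f u"
      by (auto simp: orbit_def Aut_def)
    then have bij: "bij_betw f (lucas_strings n) (lucas_strings n)"
      and adj: "\<And>u v. u \<in> lucas_strings n \<Longrightarrow> v \<in> lucas_strings n \<Longrightarrow> adj n (f u) (f v) \<longleftrightarrow> adj n u v"
      by (simp_all add: auto_iff)
    obtain g where "g \<in> dihedral n" "\<And>u. u \<in> lucas_strings n \<Longrightarrow> f u = dih g u"
      using lucas_cube_auto_is_dih[OF n bij adj] by blast
    then show "v \<in> (\<lambda>g. dih g u) ` dihedral n" using f(2) u by blast
  next
    fix v assume "v \<in> (\<lambda>g. dih g u) ` dihedral n"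
    then obtain g where "g \<in> dihedral n" "v = dih g u" by blast
    then show "v \<in> orbit (Aut (lucas_cube n)) (\<lambda>f. f) u"
      using dih_auto[of g] u unfolding orbit_def Aut_def
      by (auto intro!: exI[of _ "restrict (dih g) (lucas_strings n)"])
  qed
qed

theorem theorem5p1:
  fixes n :: nat
  assumes "n > 0"
  shows "real (num_vertex_orbits (lucas_cube n)) =
    1 / 2 * (1 / real n * (\<Sum>d | d dvd n. real (totient (n div d)) * real (lucas d))
      + (\<Sum>a = 0..n div 2. real ((n div 2 - (a + 1) div 2) choose (a div 2))))"
proof -
  let ?N = "num_vertex_orbits (lucas_cube n)"
  let ?A = "\<Sum>d | d dvd n. totient (n div d) * lucas d"
  let ?B = "\<Sum>a = 0..n div 2. (n div 2 - (a + 1) div 2) choose (a div 2)"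
  have "orbits (Aut (lucas_cube n)) (verts (lucas_cube n)) (\<lambda>f. f) =
      (\<lambda>u. (\<lambda>g. dih g u) ` dihedral n) ` lucas_strings n"
    unfolding orbits_def verts_lucas_cube Setcompr_eq_image
    by (rule image_cong) (simp_all add: orbit_lucas_cube[OF assms])
  \<comment> \<open>The orbit count is first an identity of natural numbers; the division by
    \<open>2 * n\<close> takes place in the reals.\<close>
  then have "2 * n * ?N = ?A + n * ?B"
    unfolding num_vertex_orbits_def
    by (simp only: sum_card_dihedral_fixed[OF assms, symmetric] sum_dihedral_fixed[OF assms])
  then have "real (2 * n * ?N) = real (?A + n * ?B)" by (rule arg_cong)
  then have "2 * real n * real ?N = real ?A + real n * real ?B"
    by (simp only: of_nat_add of_nat_mult of_nat_numeral)
  then have "real ?N = 1 / 2 * (1 / real n * real ?A + real ?B)"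
    using assms by (simp add: field_simps)
  then show ?thesis by simp
qed

end
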